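(* Consider problem (P) of the context, where $f$ is smooth with Lipschitz gradient and the $r_i$ are convex and locally Lipschitz continuous. Let $x^*=(x_1^*,\dots,x_N^* )$ with $x_i^*\in\mathcal M_i\cap X_i$ for $i=1,\dots,N-1$ and $x_N^*\in\mathbb R^{n_N}$. If there exists a Lagrange multiplier $\lambda^*\in\mathbb R^m$ such that $$\begin{cases}\nabla_Nf(x^* )-A_N^\top\lambda^*=0,\\ \sum_{i=1}^N A_ix_i^*-b=0,\\ \operatorname{Proj}_{\mathcal T_{x_i^*}\mathcal M_i}\left(\nabla_if(x^* )-A_i^\top\lambda^*+\partial r_i(x_i^* )\right)+\mathcal N_{X_i\cap\mathcal M_i}(x_i^* )\ni0,\quad i=1,\dots,N-1,\end{cases}$$ then $x^*$ is a stationary solution of (P).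
   Context: Problem (P): minimize $f(x_1,\dots,x_N)+\sum_{i=1}^{N-1}r_i(x_i)$ subject to $\sum_{i=1}^N A_ix_i=b$ with $A_N=I$, $x_N\in\mathbb R^{n_N}$, and $x_i\in\mathcal M_i\cap X_i$ for $i=1,\dots,N-1$. Here $A_i\in\mathbb R^{m\times n_i}$, $b\in\mathbb R^m$, $n_N=m$; $f:\mathbb R^{n_1}\times\cdots\times\mathbb R^{n_N}\to\mathbb R$; $\nabla_if$ is the partial gradient in block $x_i$; $r_i:\mathbb R^{n_i}\to\mathbb R$; $\partial r_i$ is the convex subdifferential; $\mathcal M_i$ is a Riemannian submanifold embedded in $\mathbb R^{n_i}$ (Euclidean metric), with tangent spaces $\mathcal T_x\mathcal M_i$; $X_i\subset\mathbb R^{n_i}$ is closed convex; $\operatorname{Proj}$ is orthogonal projection. Cones: for $C\subset\mathbb R^n$ and $x\in C$, the tangent cone $T_C(x)$ is the set of $w$ such that for all sequences $x_j\to x$ in $C$ and $t_j\downarrow0$ there are $w_j\to w$ with $x_j+t_jw_j\in C$ for all $j$. For a closed subset $S$ of a manifold $\mathcal M$, $x\in S$ and a chart $(U,\psi)$ of $\mathcal M$ at $x$: $\mathcal T_S(x)=[\mathbf D\psi(x)]^{-1}[T_{\psi(S\cap U)}(\psi(x))]$ and $\mathcal N_S(x)=\{u\in\mathcal T_x\mathcal M:\langle u,v\rangle\le0\ \forall v\in\mathcal T_S(x)\}$. Riemannian Clarke subdifferential: for $F$ locally Lipschitz on $\mathcal M$ and a chart $(U,\psi)$ at $x$, $F^\circ(x;v)=\limsup_{y\to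 x,\,t\downarrow0}\frac{F\circ\psi^{-1}(\psi(y)+t\,\mathbf D\psi(x)[v])-F\circ\psi^{-1}(\psi(y))}{t}$ for $v\in\mathcal T_x\mathcal M$, and $\partial F(x)=\{\xi\in\mathcal T_x\mathcal M:\langle\xi,v\rangle\le F^\circ(x;v)\ \forall v\in\mathcal T_x\mathcal M\}$. Stationary solution: let $\mathcal M=\mathcal M_1\times\cdots\times\mathcal M_{N-1}\times\mathbb R^{n_N}$, let $S\subset\mathcal M$ be the feasible set of (P), and let $F=(f+\sum_{i=1}^{N-1}r_i)|_{\mathcal M}$. A feasible point $x^*$ is a stationary solution of (P) if $0\in\partial F(x^* )+\mathcal N_S(x^* )$, i.e. $\partial F(x^* )\cap(-\mathcal N_S(x^* ))\ne\emptyset$. *)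

theory Defs
  imports "HOL-Analysis.Analysis"
begin

text \<open>
  Smoothness. \<open>cont_diff k\<close> is \<open>C\<^sup>k\<close> and is only meaningful on open sets. A map on an
  arbitrary subset of a Euclidean space is smooth if it locally extends to a smooth map on an
  open set of the ambient space.
\<close>

primrec cont_diff ::
    "nat \<Rightarrow> ('a::real_normed_vector \<Rightarrow> 'b::real_normed_vector) \<Rightarrow> 'a set \<Rightarrow> bool" where
  "cont_diff 0 f S \<longleftrightarrow> continuous_on S f"
| "cont_diff (Suc k) f S \<longleftrightarrow>
     f differentiable_on S \<and> (\<forall>v. cont_diff k (\<lambda>x. frechet_derivative f (at x) v) S)"

definition smooth_open :: "('a::real_normed_vector \<Rightarrow> 'b::real_normed_vector) \<Rightarrow> 'a set \<Rightarrow> bool" where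
  "smooth_open f S \<longleftrightarrow> open S \<and> (\<forall>k. cont_diff k f S)"

definition smooth_map :: "'a::euclidean_space set \<Rightarrow> ('a \<Rightarrow> 'b::euclidean_space) \<Rightarrow> bool" where
  "smooth_map S f \<longleftrightarrow>
     (\<forall>x\<in>S. \<exists>V g. x \<in> V \<and> smooth_open g V \<and> (\<forall>y\<in>S \<inter> V. g y = f y))"

text \<open>
  Embedded submanifolds of a Euclidean space \<open>'a\<close> (of class \<open>C\<^sup>\<infinity>\<close>, without boundary), in the
  form: locally diffeomorphic to an open subset of \<open>\<real>\<^sup>d\<close>. So that \<open>d\<close> can be a number rather than
  a type, \<open>\<real>\<^sup>d\<close> is represented by a \<open>d\<close>-dimensional linear subspace of \<open>'a\<close> (every \<open>d\<close> that can
  occur is at most the dimension of \<open>'a\<close>).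
\<close>

definition chart_dim :: "nat \<Rightarrow> 'a::euclidean_space set \<Rightarrow> 'a set \<Rightarrow> ('a \<Rightarrow> 'a) \<Rightarrow> bool" where
  "chart_dim d M U \<psi> \<longleftrightarrow>
     openin (top_of_set M) U \<and>
     (\<exists>E. subspace E \<and> dim E = d \<and> openin (top_of_set E) (\<psi> ` U)) \<and>
     inj_on \<psi> U \<and> smooth_map U \<psi> \<and> smooth_map (\<psi> ` U) (inv_into U \<psi>)"

definition embedded_submanifold :: "'a::euclidean_space set \<Rightarrow> bool" where
  "embedded_submanifold M \<longleftrightarrow> (\<exists>d. \<forall>x\<in>M. \<exists>U \<psi>. x \<in> U \<and> chart_dim d M U \<psi>)"

definition chart_at :: "'a::euclidean_space set \<Rightarrow> 'a \<Rightarrow> 'a set \<Rightarrow> ('a \<Rightarrow> 'a) \<Rightarrow> bool" where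
  "chart_at M x U \<psi> \<longleftrightarrow> x \<in> U \<and> (\<exists>d. chart_dim d M U \<psi>)"

definition tangent_space :: "'a::euclidean_space set \<Rightarrow> 'a \<Rightarrow> 'a set" where
  "tangent_space M x =
     {v. \<exists>\<gamma>::real \<Rightarrow> 'a. \<exists>e>0. smooth_open \<gamma> {-e<..<e} \<and> (\<forall>t\<in>{-e<..<e}. \<gamma> t \<in> M) \<and>
         \<gamma> 0 = x \<and> (\<gamma> has_vector_derivative v) (at 0)}"

text \<open>
  The differential \<open>D\<psi>(x)[v]\<close> of a chart. The derivative of \<open>\<psi>\<close> at \<open>x\<close> within \<open>U\<close> is not unique as
  a linear map on the ambient space, but its values on \<^term>\<open>tangent_space M x\<close> are, and it is only
  ever applied to tangent vectors.
\<close>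

definition chart_deriv :: "'a::euclidean_space set \<Rightarrow> ('a \<Rightarrow> 'a) \<Rightarrow> 'a \<Rightarrow> 'a \<Rightarrow> 'a" where
  "chart_deriv U \<psi> x v = frechet_derivative \<psi> (at x within U) v"

definition tangent_cone :: "'a::euclidean_space set \<Rightarrow> 'a \<Rightarrow> 'a set" where
  "tangent_cone C x =
     {w. \<forall>(s::nat \<Rightarrow> 'a) (t::nat \<Rightarrow> real).
           (\<forall>j. s j \<in> C) \<and> s \<longlonglongrightarrow> x \<and> (\<forall>j. t j > 0) \<and> t \<longlonglongrightarrow> 0 \<longrightarrow>
           (\<exists>w'. w' \<longlonglongrightarrow> w \<and> (\<forall>j. s j + t j *\<^sub>R w' j \<in> C))}"

text \<open>
  The next notions are computed in a given chart \<open>(U, \<psi>)\<close> of \<open>M\<close> at \<open>x\<close>; \<open>S \<subseteq> M\<close> is relatively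
  closed in \<open>M\<close> with \<open>x \<in> S\<close>, and \<open>F\<close> is locally Lipschitz on \<open>M\<close>.
\<close>

definition mfd_tangent_cone ::
    "'a::euclidean_space set \<Rightarrow> 'a set \<Rightarrow> ('a \<Rightarrow> 'a) \<Rightarrow> 'a set \<Rightarrow> 'a \<Rightarrow> 'a set" where
  "mfd_tangent_cone M U \<psi> S x =
     {v \<in> tangent_space M x. chart_deriv U \<psi> x v \<in> tangent_cone (\<psi> ` (S \<inter> U)) (\<psi> x)}"

definition mfd_normal_cone ::
    "'a::euclidean_space set \<Rightarrow> 'a set \<Rightarrow> ('a \<Rightarrow> 'a) \<Rightarrow> 'a set \<Rightarrow> 'a \<Rightarrow> 'a set" where
  "mfd_normal_cone M U \<psi> S x =
     {u \<in> tangent_space M x. \<forall>v\<in>mfd_tangent_cone M U \<psi> S x. u \<bullet> v \<le> 0}"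

text \<open>
  The base point \<open>y \<rightarrow> x\<close> of the upper limit ranges over \<open>U\<close> and may be equal to \<open>x\<close>, hence
  \<^const>\<open>nhds\<close> rather than \<open>at\<close>. As \<open>\<psi> ` U\<close> is open in the coordinate space,
  \<open>\<psi> y + t D\<psi>(x)[v]\<close> eventually lies in \<open>\<psi> ` U\<close>.
\<close>

definition clarke_dderiv ::
    "'a::euclidean_space set \<Rightarrow> ('a \<Rightarrow> 'a) \<Rightarrow> ('a \<Rightarrow> real) \<Rightarrow> 'a \<Rightarrow> 'a \<Rightarrow> ereal" where
  "clarke_dderiv U \<psi> F x v =
     Limsup (inf (nhds x) (principal U) \<times>\<^sub>F at_right 0)
       (\<lambda>(y, t). ereal ((F (inv_into U \<psi> (\<psi> y + t *\<^sub>R chart_deriv U \<psi> x v))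
                          - F (inv_into U \<psi> (\<psi> y))) / t))"

definition clarke_subdiff ::
    "'a::euclidean_space set \<Rightarrow> 'a set \<Rightarrow> ('a \<Rightarrow> 'a) \<Rightarrow> ('a \<Rightarrow> real) \<Rightarrow> 'a \<Rightarrow> 'a set" where
  "clarke_subdiff M U \<psi> F x =
     {\<xi> \<in> tangent_space M x. \<forall>v\<in>tangent_space M x. ereal (\<xi> \<bullet> v) \<le> clarke_dderiv U \<psi> F x v}"

definition orth_proj :: "'a::euclidean_space set \<Rightarrow> 'a \<Rightarrow> 'a" where
  "orth_proj V x = (THE p. p \<in> V \<and> (\<forall>v\<in>V. orthogonal (x - p) v))"

definition grad :: "('a::real_inner \<Rightarrow> real) \<Rightarrow> 'a \<Rightarrow> 'a" where
  "grad f x = (THE g. GDERIV f x :> g)"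

definition locally_lipschitz_on :: "'a::metric_space set \<Rightarrow> ('a \<Rightarrow> 'b::metric_space) \<Rightarrow> bool" where
  "locally_lipschitz_on S f \<longleftrightarrow> (\<forall>x\<in>S. \<exists>e>0. \<exists>L. L-lipschitz_on (cball x e \<inter> S) f)"

text \<open>Convex subdifferential of \<open>r\<close> as a function on the linear subspace \<open>V\<close>.\<close>

definition convex_subdiff :: "'a::real_inner set \<Rightarrow> ('a \<Rightarrow> real) \<Rightarrow> 'a \<Rightarrow> 'a set" where
  "convex_subdiff V r x = {g \<in> V. \<forall>y\<in>V. r x + g \<bullet> (y - x) \<le> r y}"

text \<open>
  Block structure. The blocks have different dimensions and their number \<open>N\<close> is arbitrary, so
  \<open>\<real>\<^bsup>n\<^sub>1\<^esup> \<times> \<dots> \<times> \<real>\<^bsup>n\<^sub>N\<^esup>\<close> is represented by \<open>(real^'k) \<times> (real^'m)\<close>: the coordinates \<open>'k\<close> of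
  \<open>(x\<^sub>1, \<dots>, x\<^bsub>N-1\<^esub>)\<close> are distributed over the blocks by \<open>blk :: 'k \<Rightarrow> nat\<close>, and \<open>x\<^sub>N\<close> is the second
  component, which lives in \<open>\<real>\<^sup>m\<close> because \<open>n\<^sub>N = m\<close>. For \<open>i < N\<close> the space \<open>\<real>\<^bsup>n\<^sub>i\<^esup>\<close> is
  \<^term>\<open>blk_space blk i\<close>, the vectors supported on the coordinates of block \<open>i\<close>. Accordingly the
  \<open>m \<times> n\<^sub>i\<close> matrix \<open>A\<^sub>i\<close> is a matrix of type \<open>real^'k^'m\<close> whose columns outside block \<open>i\<close> vanish.
\<close>

definition blk_space :: "('k::finite \<Rightarrow> nat) \<Rightarrow> nat \<Rightarrow> (real^'k) set" where
  "blk_space blk i = {x. \<forall>c. blk c \<noteq> i \<longrightarrow> x $ c = 0}"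

definition block :: "('k::finite \<Rightarrow> nat) \<Rightarrow> nat \<Rightarrow> (real^'k) \<times> (real^'m) \<Rightarrow> real^'k" where
  "block blk i x = (\<chi> c. if blk c = i then fst x $ c else 0)"

definition last_block :: "(real^'k) \<times> (real^'m) \<Rightarrow> real^'m" where
  "last_block x = snd x"

definition lhs ::
    "nat \<Rightarrow> ('k::finite \<Rightarrow> nat) \<Rightarrow> (nat \<Rightarrow> real^'k^'m) \<Rightarrow> (real^'k) \<times> (real^'m) \<Rightarrow> real^'m" where
  "lhs N blk A x = (\<Sum>i\<in>{1..<N}. A i *v block blk i x) + mat 1 *v last_block x"

definition product_manifold ::
    "nat \<Rightarrow> ('k::finite \<Rightarrow> nat) \<Rightarrow> (nat \<Rightarrow> (real^'k) set) \<Rightarrow> ((real^'k) \<times> (real^'m)) set" where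
  "product_manifold N blk M = {x. \<forall>i\<in>{1..<N}. block blk i x \<in> M i}"

definition feasible_set ::
    "nat \<Rightarrow> ('k::finite \<Rightarrow> nat) \<Rightarrow> (nat \<Rightarrow> real^'k^'m) \<Rightarrow> real^'m \<Rightarrow>
     (nat \<Rightarrow> (real^'k) set) \<Rightarrow> (nat \<Rightarrow> (real^'k) set) \<Rightarrow> ((real^'k) \<times> (real^'m)) set" where
  "feasible_set N blk A b M X =
     {x. (\<forall>i\<in>{1..<N}. block blk i x \<in> M i \<inter> X i) \<and> lhs N blk A x = b}"

definition objective ::
    "nat \<Rightarrow> ('k::finite \<Rightarrow> nat) \<Rightarrow> ((real^'k) \<times> (real^'m) \<Rightarrow> real) \<Rightarrow> (nat \<Rightarrow> real^'k \<Rightarrow> real) \<Rightarrow>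
     (real^'k) \<times> (real^'m) \<Rightarrow> real" where
  "objective N blk f r x = f x + (\<Sum>i\<in>{1..<N}. r i (block blk i x))"

text \<open>
  The generalised stationarity condition does not depend on the chart; it is required in every
  chart at \<open>x\<close>. The sum in it is the Minkowski sum.
\<close>

definition stationary_solution ::
    "nat \<Rightarrow> ('k::finite \<Rightarrow> nat) \<Rightarrow> ((real^'k) \<times> (real^'m) \<Rightarrow> real) \<Rightarrow> (nat \<Rightarrow> real^'k \<Rightarrow> real) \<Rightarrow>
     (nat \<Rightarrow> real^'k^'m) \<Rightarrow> real^'m \<Rightarrow> (nat \<Rightarrow> (real^'k) set) \<Rightarrow> (nat \<Rightarrow> (real^'k) set) \<Rightarrow>
     (real^'k) \<times> (real^'m) \<Rightarrow> bool" where
  "stationary_solution N blk f r A b M X x \<longleftrightarrow>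
     (let \<M> = product_manifold N blk M; S = feasible_set N blk A b M X; F = objective N blk f r
      in x \<in> S \<and>
         (\<forall>U \<psi>. chart_at \<M> x U \<psi> \<longrightarrow>
            0 \<in> clarke_subdiff \<M> U \<psi> F x + mfd_normal_cone \<M> U \<psi> S x))"

definition grad_block ::
    "('k::finite \<Rightarrow> nat) \<Rightarrow> nat \<Rightarrow> ((real^'k) \<times> (real^'m) \<Rightarrow> real) \<Rightarrow> (real^'k) \<times> (real^'m) \<Rightarrow> real^'k"
  where "grad_block blk i f x = block blk i (grad f x)"

definition grad_last ::
    "((real^'k) \<times> (real^'m) \<Rightarrow> real) \<Rightarrow> (real^'k) \<times> (real^'m) \<Rightarrow> real^'m"
  where "grad_last f x = last_block (grad f x)"

end

theory Submission
  imports Defs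
begin

text \<open>
  Let \<open>g\<^sub>i \<in> \<partial>r\<^sub>i\<close> be the subgradients of the KKT system and \<open>\<xi>\<close> the projection of \<open>\<nabla>f + g\<close> onto the
  tangent space of the product manifold. Bounding the upper limit in the Clarke derivative from
  below along \<open>y = x\<close> and using convexity of the \<open>r\<^sub>i\<close> shows that \<open>\<xi>\<close> is a Clarke subgradient.
  For \<open>v\<close> in the tangent cone of the feasible set, \<open>\<Sum>A\<^sub>iv\<^sub>i = 0\<close> removes the multiplier from
  \<open>\<langle>\<xi>, v\<rangle>\<close>, which becomes a sum of \<open>-\<langle>n\<^sub>i, v\<^sub>i\<rangle>\<close> with \<open>n\<^sub>i \<in> N(x\<^sub>i)\<close>, so \<open>-\<xi>\<close> is normal as soon as
  each \<open>v\<^sub>i\<close> lies in the tangent cone of \<open>X\<^sub>i \<inter> M\<^sub>i\<close>. The latter holds because \<open>A\<^sub>N = I\<close> makes the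
  feasible set a graph over the product of the \<open>X\<^sub>i \<inter> M\<^sub>i\<close>. Charts are eliminated by strict
  differentiability of \<open>C\<^sup>1\<close> maps: membership in a tangent cone then only concerns sequences
  in the ambient space.
\<close>

subsection \<open>Smooth maps and strict differentiability\<close>

text \<open>The derivative of P o f is \<open>P\<close> applied to the derivative of
  \<open>f\<close>, so the case \<open>Suc k\<close> reduces to the same claim for \<open>k\<close>.
  Agreement is asked on \<open>S\<close> only, because the derivative of \<open>g\<close> is
  computed from that of \<open>f\<close> only at points of \<open>S\<close>.\<close>

lemma cont_diff_linear_comp:
  assumes "open S" "bounded_linear P" "cont_diff k f S" "\<And>x. x \<in> S \<Longrightarrow> g x = P (f x)"
  shows "cont_diff k g S"
  using assms(3,4)
proof (induction k arbitrary: f g)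
  case 0
  have "continuous_on S (\<lambda>x. P (f x))"
    using 0(1) bounded_linear.continuous_on[OF assms(2)] by simp
  then show ?case using 0(2) by (simp cong: continuous_on_cong)
next
  case (Suc k)
  have deriv: "(g has_derivative (\<lambda>v. P (frechet_derivative f (at x) v))) (at x)" if "x \<in> S" for x
  proof -
    have "(f has_derivative frechet_derivative f (at x)) (at x)"
      using Suc.prems(1) that \<open>open S\<close>
      by (simp add: differentiable_on_eq_differentiable_at frechet_derivative_works[symmetric])
    then have "((\<lambda>x. P (f x)) has_derivative (\<lambda>v. P (frechet_derivative f (at x) v))) (at x)"
      by (rule bounded_linear.has_derivative[OF assms(2)])
    then show ?thesis
      by (rule has_derivative_transform_within_open[OF _ \<open>open S\<close> that]) (simp add: Suc.prems(2))
  qed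
  have "g differentiable_on S"
    unfolding differentiable_on_def
    using deriv by (meson differentiable_def has_derivative_at_withinI)
  moreover have "cont_diff k (\<lambda>x. frechet_derivative g (at x) v) S" for v
  proof (rule Suc.IH)
    show "cont_diff k (\<lambda>x. frechet_derivative f (at x) v) S" using Suc.prems(1) by simp
    show "frechet_derivative g (at x) v = P (frechet_derivative f (at x) v)" if "x \<in> S" for x
      using frechet_derivative_at[OF deriv[OF that]] by metis
  qed
  ultimately show ?case by simp
qed

text \<open>Differentiating t -> h (c + t w) in direction s gives the derivative of \<open>h\<close>
  in the fixed direction s w, again evaluated along the line. Inner maps that are affine thus close
  the induction without product terms.\<close>

lemma cont_diff_along_line:
  fixes S :: "real set"
  assumes "open S" "open V" "\<And>t. t \<in> S \<Longrightarrow> c + t *\<^sub>R w \<in> V"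
    "cont_diff k h V" "\<And>t. t \<in> S \<Longrightarrow> g t = h (c + t *\<^sub>R w)"
  shows "cont_diff k g S"
  using assms(4,5)
proof (induction k arbitrary: h g)
  case 0
  have "continuous_on S (\<lambda>t. h (c + t *\<^sub>R w))"
    by (rule continuous_on_compose2[of V h]) (use 0 assms(3) in \<open>auto intro!: continuous_intros\<close>)
  then show ?case using 0(2) by (simp cong: continuous_on_cong)
next
  case (Suc k)
  have deriv: "(g has_derivative (\<lambda>s. frechet_derivative h (at (c + t *\<^sub>R w)) (s *\<^sub>R w))) (at t)"
    if "t \<in> S" for t
  proof -
    have "(h has_derivative frechet_derivative h (at (c + t *\<^sub>R w))) (at (c + t *\<^sub>R w))"
      using Suc.prems(1) assms(3)[OF that] \<open>open V\<close>
      by (simp add: differentiable_on_eq_differentiable_at frechet_derivative_works[symmetric])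
    moreover have "((\<lambda>t. c + t *\<^sub>R w) has_derivative (\<lambda>s. s *\<^sub>R w)) (at t)"
      by (auto intro!: derivative_eq_intros)
    ultimately have "((\<lambda>t. h (c + t *\<^sub>R w)) has_derivative
        (\<lambda>s. frechet_derivative h (at (c + t *\<^sub>R w)) (s *\<^sub>R w))) (at t)"
      using has_derivative_compose by fastforce
    then show ?thesis
      by (rule has_derivative_transform_within_open[OF _ \<open>open S\<close> that]) (simp add: Suc.prems(2))
  qed
  have "g differentiable_on S"
    unfolding differentiable_on_def
    using deriv by (meson differentiable_def has_derivative_at_withinI)
  moreover have "cont_diff k (\<lambda>t. frechet_derivative g (at t) s) S" for s
  proof (rule Suc.IH)
    show "cont_diff k (\<lambda>y. frechet_derivative h (at y) (s *\<^sub>R w)) V" using Suc.prems(1) by simp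
    show "frechet_derivative g (at t) s = frechet_derivative h (at (c + t *\<^sub>R w)) (s *\<^sub>R w)"
      if "t \<in> S" for t
      using frechet_derivative_at[OF deriv[OF that]] by metis
  qed
  ultimately show ?case by simp
qed

text \<open>Two-point differentiability relative to \<open>S\<close>: both ends of the increment may
  move. This fits tangent cones, whose test sequences have moving base points. Relative to a thin
  set \<open>S\<close> the linear map \<open>f'\<close> need not be unique.\<close>

definition strict_derivative_within ::
    "('a::real_normed_vector \<Rightarrow> 'b::real_normed_vector) \<Rightarrow> ('a \<Rightarrow> 'b) \<Rightarrow> 'a \<Rightarrow> 'a set \<Rightarrow> bool" where
  "strict_derivative_within f f' a S \<longleftrightarrow> bounded_linear f' \<and>
     (\<forall>e>0. \<exists>d>0. \<forall>y\<in>S \<inter> ball a d. \<forall>z\<in>S \<inter> ball a d.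
        norm (f z - f y - f' (z - y)) \<le> e * norm (z - y))"

text \<open>Mean value inequality for \<open>g\<close> minus its linearisation at \<open>a\<close>,
  on a ball so small that the derivative of \<open>g\<close> there differs from the one at
  \<open>a\<close> by at most e in operator norm.\<close>

lemma smooth_open_strict_derivative:
  fixes g :: "'a::euclidean_space \<Rightarrow> 'b::euclidean_space"
  assumes "smooth_open g V" "a \<in> V"
  shows "strict_derivative_within g (frechet_derivative g (at a)) a V"
proof -
  let ?D = "\<lambda>y. frechet_derivative g (at y)"
  have V: "open V" and "cont_diff (Suc 0) g V" using assms(1) unfolding smooth_open_def by blast+
  then have D: "(g has_derivative ?D y) (at y)" if "y \<in> V" for y
    using that by (simp add: differentiable_on_eq_differentiable_at frechet_derivative_works[symmetric])
  have cont: "continuous_on V (\<lambda>y. ?D y v)" for v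
    using \<open>cont_diff (Suc 0) g V\<close> by simp
  have "\<exists>d>0. \<forall>y\<in>V \<inter> ball a d. \<forall>z\<in>V \<inter> ball a d.
      norm (g z - g y - ?D a (z - y)) \<le> e * norm (z - y)" if "e > 0" for e
  proof -
    \<comment> \<open>\<open>cont_diff\<close> gives continuity of the derivative in each fixed
      direction only. Summing over the basis turns this into a bound on the operator norm.\<close>
    have "((\<lambda>y. \<Sum>i\<in>Basis. norm (?D y i - ?D a i)) \<longlongrightarrow> (\<Sum>i\<in>(Basis::'a set). norm (?D a i - ?D a i))) (nhds a)"
    proof (intro tendsto_intros)
      fix i
      have "continuous (at a) (\<lambda>y. ?D y i)"
        using cont V \<open>a \<in> V\<close> by (simp add: continuous_on_eq_continuous_at)
      then show "((\<lambda>y. ?D y i) \<longlongrightarrow> ?D a i) (nhds a)"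
        by (metis isCont_def tendsto_at_iff_tendsto_nhds)
    qed
    then have "((\<lambda>y. \<Sum>i\<in>Basis. norm (?D y i - ?D a i)) \<longlongrightarrow> 0) (nhds a)" by simp
    then have "\<forall>\<^sub>F y in nhds a. (\<Sum>i\<in>Basis. norm (?D y i - ?D a i)) < e"
      using \<open>e > 0\<close> by (rule order_tendstoD)
    moreover have "\<forall>\<^sub>F y in nhds a. y \<in> V"
      using V \<open>a \<in> V\<close> by (rule eventually_nhds_in_open)
    ultimately have "\<forall>\<^sub>F y in nhds a. y \<in> V \<and> (\<Sum>i\<in>Basis. norm (?D y i - ?D a i)) < e"
      by eventually_elim simp
    then obtain d where "d > 0"
      and d: "\<And>y. dist y a < d \<Longrightarrow> y \<in> V \<and> (\<Sum>i\<in>Basis. norm (?D y i - ?D a i)) < e"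
      unfolding eventually_nhds_metric by blast
    have "norm (g z - g y - ?D a (z - y)) \<le> e * norm (z - y)"
      if "y \<in> ball a d" "z \<in> ball a d" for y z
    proof -
      have bl: "bounded_linear (\<lambda>v. ?D u v - ?D a v)" if "u \<in> ball a d" for u
      proof -
        have "u \<in> V" using d that by (simp add: dist_commute)
        then show ?thesis
          using D \<open>a \<in> V\<close> has_derivative_bounded_linear bounded_linear_sub by blast
      qed
      have "norm (g z - g y - ?D a (z - y)) \<le> norm (z - y) * e"
      proof (rule differentiable_bound_linearization[where S = "ball a d" and f' = ?D])
        show "y + t *\<^sub>R (z - y) \<in> ball a d" if "t \<in> {0..1}" for t
        proof -
          have "(1 - t) *\<^sub>R y + t *\<^sub>R z \<in> ball a d"
            using \<open>y \<in> _\<close> \<open>z \<in> _\<close> that by (intro convexD_alt[OF convex_ball]) auto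
          then show ?thesis by (simp add: algebra_simps)
        qed
        show "(g has_derivative ?D u) (at u within ball a d)" if "u \<in> ball a d" for u
          using D d that by (simp add: dist_commute has_derivative_at_withinI)
        show "onorm (?D u - ?D a) \<le> e" if "u \<in> ball a d" for u
        proof -
          have "onorm (\<lambda>v. ?D u v - ?D a v) \<le> (\<Sum>i\<in>Basis. norm (?D u i - ?D a i))"
            by (rule onorm_componentwise[OF bl[OF that]])
          also have "\<dots> \<le> e" using d[of u] that by (simp add: dist_commute)
          finally show ?thesis by (simp add: fun_diff_def)
        qed
        show "a \<in> ball a d" using \<open>d > 0\<close> by simp
      qed
      then show ?thesis by (simp add: mult.commute)
    qed
    then show ?thesis using \<open>d > 0\<close> by blast
  qed
  then show ?thesis
    unfolding strict_derivative_within_def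
    using D[OF \<open>a \<in> V\<close>] has_derivative_bounded_linear by blast
qed

text \<open>A local smooth extension has a strict derivative, and the two-point estimate survives
  restriction to points of \<open>S\<close>, where the extension agrees with
  \<open>f\<close>.\<close>

lemma smooth_map_strict_derivative:
  assumes "smooth_map S f" "a \<in> S"
  obtains f' where "strict_derivative_within f f' a S"
proof -
  obtain V g where "a \<in> V" "smooth_open g V" and eq: "\<forall>y\<in>S \<inter> V. g y = f y"
    using assms unfolding smooth_map_def by blast
  let ?D = "frechet_derivative g (at a)"
  have sg: "strict_derivative_within g ?D a V"
    by (rule smooth_open_strict_derivative) fact+
  have "open V" using \<open>smooth_open g V\<close> by (simp add: smooth_open_def)
  then obtain d0 where "d0 > 0" "ball a d0 \<subseteq> V" using \<open>a \<in> V\<close> by (meson open_contains_ball)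
  have "\<exists>d>0. \<forall>y\<in>S \<inter> ball a d. \<forall>z\<in>S \<inter> ball a d.
      norm (f z - f y - ?D (z - y)) \<le> e * norm (z - y)" if "e > 0" for e
  proof -
    obtain d where "d > 0" and d: "\<forall>y\<in>V \<inter> ball a d. \<forall>z\<in>V \<inter> ball a d.
      norm (g z - g y - ?D (z - y)) \<le> e * norm (z - y)"
      using sg \<open>e > 0\<close> unfolding strict_derivative_within_def by blast
    have "\<forall>y\<in>S \<inter> ball a (min d d0). \<forall>z\<in>S \<inter> ball a (min d d0).
        norm (f z - f y - ?D (z - y)) \<le> e * norm (z - y)"
    proof (intro ballI)
      fix y z assume yz: "y \<in> S \<inter> ball a (min d d0)" "z \<in> S \<inter> ball a (min d d0)"
      then have "y \<in> V" "z \<in> V" using \<open>ball a d0 \<subseteq> V\<close> by auto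
      then have "g y = f y" "g z = f z" using eq yz by auto
      moreover have "norm (g z - g y - ?D (z - y)) \<le> e * norm (z - y)"
        using d \<open>y \<in> V\<close> \<open>z \<in> V\<close> yz by auto
      ultimately show "norm (f z - f y - ?D (z - y)) \<le> e * norm (z - y)" by simp
    qed
    then show ?thesis using \<open>d > 0\<close> \<open>d0 > 0\<close> by (intro exI[of _ "min d d0"]) simp
  qed
  then show ?thesis using sg that unfolding strict_derivative_within_def by blast
qed

lemma strict_derivative_has_derivative:
  assumes "strict_derivative_within f f' a S" "a \<in> S"
  shows "(f has_derivative f') (at a within S)"
  unfolding has_derivative_within_alt
proof (intro conjI allI impI)
  show "bounded_linear f'" using assms(1) by (simp add: strict_derivative_within_def)
  fix e :: real assume "e > 0"
  then obtain d where "d > 0" and d: "\<forall>y\<in>S \<inter> ball a d. \<forall>z\<in>S \<inter> ball a d.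
      norm (f z - f y - f' (z - y)) \<le> e * norm (z - y)"
    using assms(1) unfolding strict_derivative_within_def by blast
  then show "\<exists>d>0. \<forall>y\<in>S. norm (y - a) < d \<longrightarrow> norm (f y - f a - f' (y - a)) \<le> e * norm (y - a)"
    using \<open>a \<in> S\<close> by (intro exI[of _ d]) (simp add: dist_norm norm_minus_commute[of a])
qed

text \<open>The quotient of \<open>f\<close> is \<open>f'\<close> of the quotient q = (z - y) / t
  plus an error of size e times norm q, and q stays bounded because it converges. The abstract
  hypothesis \<open>approx\<close> covers strict derivatives with moving base points as well as
  ordinary ones.\<close>

lemma difference_quotient_tendsto:
  fixes f :: "'a::real_normed_vector \<Rightarrow> 'b::real_normed_vector" and t :: "'c \<Rightarrow> real"
  assumes "bounded_linear f'"
    and approx: "\<And>e. e > 0 \<Longrightarrow>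
      \<forall>\<^sub>F j in F. norm (f (z j) - f (y j) - f' (z j - y j)) \<le> e * norm (z j - y j)"
    and v: "((\<lambda>j. (z j - y j) /\<^sub>R t j) \<longlongrightarrow> v) F"
  shows "((\<lambda>j. (f (z j) - f (y j)) /\<^sub>R t j) \<longlongrightarrow> f' v) F"
proof -
  let ?q = "\<lambda>j. (z j - y j) /\<^sub>R t j"
  interpret f': bounded_linear f' by fact
  have "((\<lambda>j. (f (z j) - f (y j)) /\<^sub>R t j - f' (?q j)) \<longlongrightarrow> 0) F"
  proof (rule tendstoI)
    fix e :: real assume "e > 0"
    \<comment> \<open>Chosen so that c times norm v + 1, the eventual bound on the quotients, equals
      e.\<close>
    define c where "c = e / (norm v + 1)"
    have "c > 0" using \<open>e > 0\<close> by (simp add: c_def add_nonneg_pos)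
    have "((\<lambda>j. norm (?q j)) \<longlongrightarrow> norm v) F" by (intro tendsto_intros v)
    then have "\<forall>\<^sub>F j in F. norm (?q j) < norm v + 1" by (rule order_tendstoD) simp
    then show "\<forall>\<^sub>F j in F. dist ((f (z j) - f (y j)) /\<^sub>R t j - f' (?q j)) 0 < e"
      using approx[OF \<open>c > 0\<close>]
    proof eventually_elim
      case (elim j)
      have "(f (z j) - f (y j)) /\<^sub>R t j - f' (?q j) = (f (z j) - f (y j) - f' (z j - y j)) /\<^sub>R t j"
        by (simp only: f'.scaleR flip: scaleR_diff_right)
      then have "norm ((f (z j) - f (y j)) /\<^sub>R t j - f' (?q j)) =
          norm (f (z j) - f (y j) - f' (z j - y j)) / \<bar>t j\<bar>"
        by (simp add: divide_inverse mult.commute)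
      also have "\<dots> \<le> c * norm (z j - y j) / \<bar>t j\<bar>"
        using elim by (intro divide_right_mono) auto
      also have "\<dots> = c * norm (?q j)" by (simp add: divide_inverse mult.commute)
      also have "\<dots> < c * (norm v + 1)" using elim \<open>c > 0\<close> by simp
      also have "\<dots> = e" unfolding c_def
        by (metis add_nonneg_pos less_irrefl nonzero_divide_eq_eq norm_ge_zero zero_less_one)
      finally show ?case by simp
    qed
  qed
  moreover have "((\<lambda>j. f' (?q j)) \<longlongrightarrow> f' v) F" by (rule f'.tendsto[OF v])
  ultimately show ?thesis using tendsto_add by fastforce
qed

text \<open>Here z = y + t q with q convergent and t tending to 0.\<close>

lemma difference_quotient_endpoint_tendsto:
  fixes y z :: "'c \<Rightarrow> 'a::real_normed_vector" and t :: "'c \<Rightarrow> real"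
  assumes y: "(y \<longlongrightarrow> a) F" and t: "(t \<longlongrightarrow> 0) F" "\<forall>\<^sub>F j in F. t j \<noteq> 0"
    and v: "((\<lambda>j. (z j - y j) /\<^sub>R t j) \<longlongrightarrow> v) F"
  shows "(z \<longlongrightarrow> a) F"
proof -
  have "((\<lambda>j. y j + t j *\<^sub>R ((z j - y j) /\<^sub>R t j)) \<longlongrightarrow> a + 0 *\<^sub>R v) F"
    by (intro tendsto_intros y t v)
  moreover have "\<forall>\<^sub>F j in F. y j + t j *\<^sub>R ((z j - y j) /\<^sub>R t j) = z j"
    using t(2) by eventually_elim simp
  ultimately show ?thesis
    by (simp only: scaleR_zero_left add_0_right) (rule Lim_transform_eventually)
qed

text \<open>Chain rule along moving base points: \<open>y\<close> and \<open>z\<close> both end up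
  in the ball where the strict estimate holds. It is the tool that carries directions through a
  chart and through its inverse.\<close>

lemma strict_derivative_tendsto:
  fixes t :: "'c \<Rightarrow> real"
  assumes f: "strict_derivative_within f f' a S"
    and y: "(y \<longlongrightarrow> a) F" and t: "(t \<longlongrightarrow> 0) F" "\<forall>\<^sub>F j in F. t j \<noteq> 0"
    and v: "((\<lambda>j. (z j - y j) /\<^sub>R t j) \<longlongrightarrow> v) F"
    and S: "\<forall>\<^sub>F j in F. y j \<in> S" "\<forall>\<^sub>F j in F. z j \<in> S"
  shows "((\<lambda>j. (f (z j) - f (y j)) /\<^sub>R t j) \<longlongrightarrow> f' v) F"
proof (rule difference_quotient_tendsto[OF _ _ v])
  show "bounded_linear f'" using f by (simp add: strict_derivative_within_def)
  fix e :: real assume "e > 0"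
  then obtain d where "d > 0" and d: "\<forall>y\<in>S \<inter> ball a d. \<forall>z\<in>S \<inter> ball a d.
      norm (f z - f y - f' (z - y)) \<le> e * norm (z - y)"
    using f unfolding strict_derivative_within_def by blast
  have "\<forall>\<^sub>F j in F. dist (y j) a < d" using y \<open>d > 0\<close> by (rule tendstoD)
  moreover have "\<forall>\<^sub>F j in F. dist (z j) a < d"
    using difference_quotient_endpoint_tendsto[OF y t v] \<open>d > 0\<close> by (rule tendstoD)
  ultimately show "\<forall>\<^sub>F j in F. norm (f (z j) - f (y j) - f' (z j - y j)) \<le> e * norm (z j - y j)"
    using S
  proof eventually_elim
    case (elim j)
    then have "y j \<in> S \<inter> ball a d" "z j \<in> S \<inter> ball a d" by (simp_all add: dist_commute)
    then show ?case using d by blast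
  qed
qed

text \<open>With the base point fixed at \<open>a\<close>, ordinary differentiability at
  \<open>a\<close> is enough; this serves curves and the differentiable part of the
  objective.\<close>

lemma has_derivative_difference_quotient_tendsto:
  fixes t :: "'c \<Rightarrow> real"
  assumes f: "(f has_derivative f') (at a)"
    and t: "(t \<longlongrightarrow> 0) F" "\<forall>\<^sub>F j in F. t j \<noteq> 0"
    and v: "((\<lambda>j. (z j - a) /\<^sub>R t j) \<longlongrightarrow> v) F"
  shows "((\<lambda>j. (f (z j) - f a) /\<^sub>R t j) \<longlongrightarrow> f' v) F"
proof (rule difference_quotient_tendsto[OF _ _ v])
  show "bounded_linear f'" using f by (rule has_derivative_bounded_linear)
  fix e :: real assume "e > 0"
  then obtain d where "d > 0" and d: "\<And>y. norm (y - a) < d \<Longrightarrow> norm (f y - f a - f' (y - a)) \<le> e * norm (y - a)"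
    using f unfolding has_derivative_at_alt by blast
  have "\<forall>\<^sub>F j in F. dist (z j) a < d"
    using difference_quotient_endpoint_tendsto[OF tendsto_const t v] \<open>d > 0\<close> by (rule tendstoD)
  then show "\<forall>\<^sub>F j in F. norm (f (z j) - f a - f' (z j - a)) \<le> e * norm (z j - a)"
    by eventually_elim (use d in \<open>simp add: dist_norm\<close>)
qed

subsection \<open>Tangent spaces in charts\<close>

lemma has_vector_derivative_difference_quotient:
  assumes "(\<gamma> has_vector_derivative v) (at 0)"
  shows "((\<lambda>t. (\<gamma> t - \<gamma> 0) /\<^sub>R t) \<longlongrightarrow> v) (at (0::real))"
proof -
  have ne: "\<forall>\<^sub>F t in at (0::real). t \<noteq> 0" by (simp add: eventually_at_filter)
  then have "\<forall>\<^sub>F t in at (0::real). 1 = (t - 0) /\<^sub>R t" by eventually_elim simp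
  then have "((\<lambda>t. (t - 0) /\<^sub>R t) \<longlongrightarrow> 1) (at (0::real))"
    by (rule Lim_transform_eventually[OF tendsto_const])
  then have "((\<lambda>t. (\<gamma> t - \<gamma> 0) /\<^sub>R t) \<longlongrightarrow> 1 *\<^sub>R v) (at 0)"
    by (rule has_derivative_difference_quotient_tendsto
        [OF assms[unfolded has_vector_derivative_def] tendsto_ident_at ne])
  then show ?thesis by simp
qed

lemma tangent_curve_quotient:
  assumes "v \<in> tangent_space M x"
  obtains \<gamma> :: "real \<Rightarrow> 'a::euclidean_space"
  where "\<gamma> 0 = x" "(\<gamma> has_vector_derivative v) (at 0)" "\<forall>\<^sub>F t in nhds 0. \<gamma> t \<in> M"
    "(\<gamma> \<longlongrightarrow> x) (at 0)" "((\<lambda>t. (\<gamma> t - x) /\<^sub>R t) \<longlongrightarrow> v) (at 0)"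
proof -
  obtain \<gamma> :: "real \<Rightarrow> 'a" and e where "e > 0" and M: "\<forall>t\<in>{-e<..<e}. \<gamma> t \<in> M"
    and \<gamma>: "\<gamma> 0 = x" "(\<gamma> has_vector_derivative v) (at 0)"
    using assms unfolding tangent_space_def by blast
  have "\<forall>\<^sub>F t in nhds 0. t \<in> {-e<..<e}"
    using \<open>e > 0\<close> by (intro eventually_nhds_in_open) auto
  then have "\<forall>\<^sub>F t in nhds 0. \<gamma> t \<in> M" by eventually_elim (use M in blast)
  moreover have "(\<gamma> \<longlongrightarrow> x) (at 0)"
    using has_vector_derivative_continuous[OF \<gamma>(2)] \<gamma>(1) by (simp add: continuous_within)
  ultimately show ?thesis
    using that \<gamma> has_vector_derivative_difference_quotient[OF \<gamma>(2)] by simp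
qed

lemma subspace_tendsto_closed:
  fixes E :: "'a::euclidean_space set"
  assumes "subspace E" "(f \<longlongrightarrow> l) F" "\<forall>\<^sub>F t in F. f t \<in> E" "F \<noteq> bot"
  shows "l \<in> E"
  using Lim_in_closed_set[OF closed_subspace[OF assms(1)] assms(3,4,2)] .

text \<open>\<open>U\<close> is the trace on \<open>M\<close> of an open set around
  \<open>x\<close>.\<close>

lemma chart_at_eventually_mem:
  assumes "chart_at M x U \<psi>" "(y \<longlongrightarrow> x) F" "\<forall>\<^sub>F j in F. y j \<in> M"
  shows "\<forall>\<^sub>F j in F. y j \<in> U"
proof -
  obtain O' where O': "open O'" "U = M \<inter> O'"
    using assms(1) unfolding chart_at_def chart_dim_def openin_open by blast
  then have "x \<in> O'" using assms(1) unfolding chart_at_def by blast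
  then have "\<forall>\<^sub>F j in F. y j \<in> O'" using assms(2) O'(1) by (rule topological_tendstoD[rotated 2])
  with assms(3) show ?thesis by eventually_elim (use O' in blast)
qed

text \<open>Collects what later proofs use of a chart. The linear maps \<open>g'\<close> and
  \<open>h'\<close> live on the ambient space, but they are meaningful only on the tangent space and
  on the coordinate space \<open>E\<close>. Differentiating along curves in \<open>M\<close> shows
  that \<open>h'\<close> inverts \<open>g'\<close> on tangent vectors; straight lines in
  \<open>E\<close>, mapped by the inverse chart, show that \<open>h'\<close> takes \<open>E\<close>
  into the tangent space.\<close>

lemma chart_at_coordinates:
  fixes M :: "'a::euclidean_space set"
  assumes chart: "chart_at M x U \<psi>"
  obtains E g' h' where "subspace E" "openin (top_of_set E) (\<psi> ` U)"
    "strict_derivative_within \<psi> g' x U"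
    "strict_derivative_within (inv_into U \<psi>) h' (\<psi> x) (\<psi> ` U)"
    "tangent_space M x = h' ` E"
    "\<And>v. v \<in> tangent_space M x \<Longrightarrow> chart_deriv U \<psi> x v = g' v"
    "\<And>v. v \<in> tangent_space M x \<Longrightarrow> g' v \<in> E"
    "\<And>v. v \<in> tangent_space M x \<Longrightarrow> h' (g' v) = v"
proof -
  obtain E where xU: "x \<in> U" and UM: "openin (top_of_set M) U" and E: "subspace E"
    and open\<psi>: "openin (top_of_set E) (\<psi> ` U)" and inj: "inj_on \<psi> U"
    and smooth: "smooth_map U \<psi>" "smooth_map (\<psi> ` U) (inv_into U \<psi>)"
    using chart unfolding chart_at_def chart_dim_def by blast
  let ?i = "inv_into U \<psi>"
  obtain g' where g': "strict_derivative_within \<psi> g' x U"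
    by (rule smooth_map_strict_derivative[OF smooth(1) xU])
  obtain h' where h': "strict_derivative_within ?i h' (\<psi> x) (\<psi> ` U)"
    by (rule smooth_map_strict_derivative[OF smooth(2)]) (use xU in auto)
  have dg: "(\<psi> has_derivative g') (at x within U)"
    by (rule strict_derivative_has_derivative[OF g' xU])
  have d\<psi>: "(\<psi> has_derivative frechet_derivative \<psi> (at x within U)) (at x within U)"
    using differentiableI[OF dg] by (simp only: frechet_derivative_works)
  have tan: "chart_deriv U \<psi> x v = g' v \<and> g' v \<in> E \<and> h' (g' v) = v"
    if v: "v \<in> tangent_space M x" for v
  proof -
    obtain \<gamma> where \<gamma>: "\<gamma> 0 = x" "(\<gamma> has_vector_derivative v) (at 0)" "\<forall>\<^sub>F t in nhds 0. \<gamma> t \<in> M"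
      "(\<gamma> \<longlongrightarrow> x) (at 0)" "((\<lambda>t. (\<gamma> t - x) /\<^sub>R t) \<longlongrightarrow> v) (at 0)"
      using tangent_curve_quotient[OF v] by blast
    have "(\<gamma> \<longlongrightarrow> x) (nhds 0)"
      using tendsto_at_iff_tendsto_nhds[of \<gamma> 0, unfolded \<gamma>(1)] \<gamma>(4) by blast
    then have evU: "\<forall>\<^sub>F t in nhds 0. \<gamma> t \<in> U"
      using chart_at_eventually_mem[OF chart _ \<gamma>(3)] by blast
    then have evU': "\<forall>\<^sub>F t in at 0. \<gamma> t \<in> U" by (simp add: eventually_nhds_conv_at)
    have ne: "\<forall>\<^sub>F t in at (0::real). t \<noteq> 0" by (simp add: eventually_at_filter)
    have lim: "((\<lambda>t. (\<psi> (\<gamma> t) - \<psi> x) /\<^sub>R t) \<longlongrightarrow> g' v) (at 0)"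
      by (rule strict_derivative_tendsto[OF g'])
        (use \<gamma> evU' xU ne in \<open>auto intro: tendsto_ident_at\<close>)
    have "g' v \<in> E"
    proof (rule subspace_tendsto_closed[OF E lim])
      show "\<forall>\<^sub>F t in at 0. (\<psi> (\<gamma> t) - \<psi> x) /\<^sub>R t \<in> E"
        using evU'
      proof eventually_elim
        case (elim t)
        then have "\<psi> (\<gamma> t) \<in> E" "\<psi> x \<in> E" using openin_imp_subset[OF open\<psi>] xU by auto
        then show ?case by (intro subspace_scale[OF E] subspace_diff[OF E])
      qed
    qed simp
    have "((\<lambda>t. (?i (\<psi> (\<gamma> t)) - ?i (\<psi> x)) /\<^sub>R t) \<longlongrightarrow> h' (g' v)) (at 0)"
    proof (rule strict_derivative_tendsto[OF h'])
      show "\<forall>\<^sub>F t in at 0. \<psi> (\<gamma> t) \<in> \<psi> ` U" using evU' by eventually_elim auto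
    qed (use lim xU ne in \<open>auto intro: tendsto_ident_at\<close>)
    moreover have "\<forall>\<^sub>F t in at 0. (?i (\<psi> (\<gamma> t)) - ?i (\<psi> x)) /\<^sub>R t = (\<gamma> t - x) /\<^sub>R t"
      using evU' by eventually_elim (simp add: inj xU)
    ultimately have "((\<lambda>t. (\<gamma> t - x) /\<^sub>R t) \<longlongrightarrow> h' (g' v)) (at 0)"
      by (rule Lim_transform_eventually)
    then have "h' (g' v) = v" using \<gamma>(5) by (rule tendsto_unique[rotated]) simp
    obtain I where I: "open I" "0 \<in> I" "\<And>t. t \<in> I \<Longrightarrow> \<gamma> t \<in> U"
      using evU unfolding eventually_nhds by blast
    \<comment> \<open>The derivative chosen by \<open>frechet_derivative\<close> may differ from
      \<open>g'\<close> off the tangent space. Every derivative \<open>D\<close> within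
      \<open>U\<close>, however, gives \<open>D v\<close> as the velocity of \<psi> o \<gamma> at 0,
      and a velocity is unique.\<close>
    have comp: "(\<psi> \<circ> \<gamma> has_vector_derivative D v) (at 0)"
      if D: "(\<psi> has_derivative D) (at x within U)" for D
    proof -
      have "(\<psi> has_derivative D) (at (\<gamma> 0) within \<gamma> ` I)"
        unfolding \<gamma>(1) by (rule has_derivative_subset[OF D]) (use I(3) in auto)
      moreover have "(\<gamma> has_derivative (\<lambda>t. t *\<^sub>R v)) (at 0 within I)"
        using \<gamma>(2) unfolding has_vector_derivative_def by (rule has_derivative_at_withinI)
      ultimately have "(\<psi> \<circ> \<gamma> has_derivative D \<circ> (\<lambda>t. t *\<^sub>R v)) (at 0 within I)"
        by (rule diff_chain_within[rotated])
      then have "(\<psi> \<circ> \<gamma> has_derivative D \<circ> (\<lambda>t. t *\<^sub>R v)) (at 0)"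
        by (simp only: at_within_open[OF I(2,1)])
      moreover have "D \<circ> (\<lambda>t. t *\<^sub>R v) = (\<lambda>t. t *\<^sub>R D v)"
        by (simp only: o_def linear_cmul[OF has_derivative_linear[OF D]])
      ultimately show ?thesis by (simp only: has_vector_derivative_def)
    qed
    have "chart_deriv U \<psi> x v = g' v"
      unfolding chart_deriv_def
      using vector_derivative_unique_at[OF comp[OF d\<psi>] comp[OF dg]] .
    then show ?thesis using \<open>g' v \<in> E\<close> \<open>h' (g' v) = v\<close> by blast
  qed
  have "h' w \<in> tangent_space M x" if "w \<in> E" for w
  proof -
    obtain V h where V: "\<psi> x \<in> V" "smooth_open h V" and h: "\<forall>y\<in>\<psi> ` U \<inter> V. h y = ?i y"
      using smooth(2) xU unfolding smooth_map_def by blast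
    obtain O' where O': "open O'" "\<psi> ` U = E \<inter> O'" using open\<psi> unfolding openin_open by blast
    have "open V" using V(2) by (simp add: smooth_open_def)
    \<comment> \<open>The line through \<psi> x in direction w, mapped by a smooth extension of the
      inverse chart. For small t the line stays in the image of the chart, so the curve stays in
      \<open>M\<close>.\<close>
    define \<gamma> where "\<gamma> = (\<lambda>t::real. h (\<psi> x + t *\<^sub>R w))"
    have lim: "((\<lambda>t::real. \<psi> x + t *\<^sub>R w) \<longlongrightarrow> \<psi> x + 0 *\<^sub>R w) (nhds 0)"
      by (intro tendsto_intros) (simp add: filterlim_ident)
    have "\<psi> x + 0 *\<^sub>R w \<in> V \<inter> O'" using V(1) O'(2) xU by auto
    then have "\<forall>\<^sub>F t in nhds (0::real). \<psi> x + t *\<^sub>R w \<in> V \<inter> O'"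
      by (rule topological_tendstoD[OF lim open_Int[OF \<open>open V\<close> O'(1)]])
    then obtain e where "e > 0" and e: "\<And>t::real. dist t 0 < e \<Longrightarrow> \<psi> x + t *\<^sub>R w \<in> V \<inter> O'"
      unfolding eventually_nhds_metric by blast
    have in\<psi>: "\<psi> x + t *\<^sub>R w \<in> \<psi> ` U \<inter> V" if "t \<in> {-e<..<e}" for t
    proof -
      have "\<psi> x \<in> E" using O'(2) xU by blast
      then have "\<psi> x + t *\<^sub>R w \<in> E"
        using \<open>w \<in> E\<close> by (intro subspace_add[OF E] subspace_scale[OF E])
      moreover have "dist t 0 < e" using that by (auto simp: dist_norm)
      ultimately show ?thesis using e O'(2) by blast
    qed
    have "smooth_open \<gamma> {-e<..<e}"
      unfolding smooth_open_def
    proof (intro conjI allI)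
      fix k
      show "cont_diff k \<gamma> {-e<..<e}"
        by (rule cont_diff_along_line[where c = "\<psi> x" and w = w and h = h and V = V])
          (use in\<psi> V \<open>open V\<close> in \<open>auto simp: smooth_open_def \<gamma>_def\<close>)
    qed simp
    moreover have M: "\<gamma> t \<in> M" if "t \<in> {-e<..<e}" for t
    proof -
      have "\<gamma> t = ?i (\<psi> x + t *\<^sub>R w)" using in\<psi>[OF that] h unfolding \<gamma>_def by blast
      then have "\<gamma> t \<in> U" using in\<psi>[OF that] by (auto intro: inv_into_into)
      then show ?thesis using openin_imp_subset[OF UM] by blast
    qed
    moreover have "\<gamma> 0 = x" using in\<psi>[of 0] h \<open>e > 0\<close> xU inj by (simp add: \<gamma>_def)
    moreover have "(\<gamma> has_vector_derivative h' w) (at 0)"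
    proof -
      have "(?i has_derivative h') (at (\<psi> x) within \<psi> ` U)"
        by (rule strict_derivative_has_derivative[OF h']) (use xU in auto)
      then have 1: "(?i has_derivative h') (at (\<psi> x + 0 *\<^sub>R w) within (\<lambda>t::real. \<psi> x + t *\<^sub>R w) ` {-e<..<e})"
        using in\<psi> by (simp only: scaleR_zero_left add_0_right) (rule has_derivative_subset, auto)
      have 2: "((\<lambda>t::real. \<psi> x + t *\<^sub>R w) has_derivative (\<lambda>t. t *\<^sub>R w)) (at 0 within {-e<..<e})"
        by (auto intro!: derivative_eq_intros)
      have "(?i \<circ> (\<lambda>t. \<psi> x + t *\<^sub>R w) has_derivative h' \<circ> (\<lambda>t. t *\<^sub>R w)) (at 0 within {-e<..<e})"
        by (rule diff_chain_within[OF 2 1])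
      then have "(?i \<circ> (\<lambda>t. \<psi> x + t *\<^sub>R w) has_derivative h' \<circ> (\<lambda>t. t *\<^sub>R w)) (at 0)"
        using \<open>e > 0\<close> by (subst (asm) at_within_open) auto
      then have "(\<gamma> has_derivative h' \<circ> (\<lambda>t. t *\<^sub>R w)) (at 0)"
        by (rule has_derivative_transform_within_open[where s = "{-e<..<e}"])
          (use \<open>e > 0\<close> in\<psi> h in \<open>auto simp: \<gamma>_def\<close>)
      moreover have "h' \<circ> (\<lambda>t. t *\<^sub>R w) = (\<lambda>t. t *\<^sub>R h' w)"
        using h' unfolding strict_derivative_within_def
        by (auto simp: linear_cmul bounded_linear.linear)
      ultimately show ?thesis by (simp add: has_vector_derivative_def)
    qed
    ultimately show ?thesis unfolding tangent_space_def using \<open>e > 0\<close> by blast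
  qed
  then have "h' ` E \<subseteq> tangent_space M x" by (rule image_subsetI)
  moreover have "tangent_space M x \<subseteq> h' ` E"
  proof
    fix v assume "v \<in> tangent_space M x"
    then have "h' (g' v) = v" "g' v \<in> E" using tan by simp_all
    then show "v \<in> h' ` E" by force
  qed
  ultimately have T: "tangent_space M x = h' ` E" by (rule equalityI[rotated])
  show ?thesis
  proof (rule that[OF E open\<psi> g' h' T])
    fix v assume "v \<in> tangent_space M x"
    from tan[OF this] show "chart_deriv U \<psi> x v = g' v" "g' v \<in> E" "h' (g' v) = v" by simp_all
  qed
qed

text \<open>Sums of velocities of curves in \<open>M\<close> are not visibly velocities; in a chart
  the tangent space is a linear image of the coordinate subspace.\<close>

lemma subspace_tangent_space:
  assumes "chart_at M x U \<psi>"
  shows "subspace (tangent_space M x)"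
proof -
  obtain E h' where "subspace E" "strict_derivative_within (inv_into U \<psi>) h' (\<psi> x) (\<psi> ` U)"
    "tangent_space M x = h' ` E"
    using chart_at_coordinates[OF assms] by metis
  then show ?thesis
    by (simp add: strict_derivative_within_def bounded_linear.linear linear_subspace_image)
qed

section \<open>Orthogonal projections, gradients and linear images of tangent vectors\<close>

lemma orth_proj_subspace:
  assumes "subspace V"
  shows "orth_proj V x \<in> V" "\<And>v. v \<in> V \<Longrightarrow> orth_proj V x \<bullet> v = x \<bullet> v"
proof -
  obtain p z where p: "p \<in> span V" "\<And>w. w \<in> span V \<Longrightarrow> orthogonal z w" "x = p + z"
    using orthogonal_subspace_decomp_exists by blast
  moreover have "span V = V" using assms by (simp add: span_eq_iff)
  ultimately have P: "p \<in> V \<and> (\<forall>v\<in>V. orthogonal (x - p) v)" by simp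
  have "q = p" if "q \<in> V \<and> (\<forall>v\<in>V. orthogonal (x - q) v)" for q
  proof -
    have "p - q \<in> V" using P that assms by (simp add: subspace_diff)
    then have "(x - q) \<bullet> (p - q) = 0" "(x - p) \<bullet> (p - q) = 0"
      using P that by (auto simp: orthogonal_def)
    then have "((x - q) - (x - p)) \<bullet> (p - q) = 0" by (simp only: inner_diff_left)
    then have "(p - q) \<bullet> (p - q) = 0" by simp
    then show ?thesis by simp
  qed
  then have eq: "orth_proj V x = p" unfolding orth_proj_def using P by (intro the_equality) blast+
  show "orth_proj V x \<in> V" using eq P by simp
  show "orth_proj V x \<bullet> v = x \<bullet> v" if "v \<in> V" for v
    using P that eq by (simp add: orthogonal_def inner_diff_left)
qed

lemma grad_has_derivative:
  fixes f :: "'a::euclidean_space \<Rightarrow> real"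
  assumes "f differentiable (at x)"
  shows "(f has_derivative (\<lambda>v. grad f x \<bullet> v)) (at x)"
proof -
  obtain f' where f': "(f has_derivative f') (at x)" using assms unfolding differentiable_def by blast
  \<comment> \<open>The Riesz representative of the functional \<open>f'\<close>.\<close>
  define D where "D = adjoint f' 1"
  have "f' v = v \<bullet> D" for v
    using adjoint_works[OF has_derivative_linear[OF f'], of v 1] by (simp add: D_def)
  then have "f' = (\<lambda>v. v \<bullet> D)" by (rule ext)
  then have D: "GDERIV f x :> D" using f' by (simp add: gderiv_def)
  have "grad f x = D"
    unfolding grad_def
  proof (rule the_equality, rule D)
    fix D' assume "GDERIV f x :> D'"
    then have "(\<lambda>v. v \<bullet> D') = (\<lambda>v. v \<bullet> D)"
      using D has_derivative_unique unfolding gderiv_def by blast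
    then have "v \<bullet> D' = v \<bullet> D" for v by (rule fun_cong)
    then show "D' = D" using vector_eq_ldot by blast
  qed
  then show ?thesis using D by (simp add: gderiv_def inner_commute)
qed

text \<open>Composing a curve in \<open>M\<close> with \<open>P\<close> gives a curve in
  \<open>M'\<close>.\<close>

lemma tangent_space_linear_image:
  fixes P :: "'a::euclidean_space \<Rightarrow> 'b::euclidean_space"
  assumes "bounded_linear P" "P ` M \<subseteq> M'" "v \<in> tangent_space M x"
  shows "P v \<in> tangent_space M' (P x)"
proof -
  obtain \<gamma> :: "real \<Rightarrow> 'a" and e where \<gamma>: "e > 0" "smooth_open \<gamma> {-e<..<e}"
    "\<forall>t\<in>{-e<..<e}. \<gamma> t \<in> M" "\<gamma> 0 = x" "(\<gamma> has_vector_derivative v) (at 0)"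
    using assms(3) unfolding tangent_space_def by blast
  have "smooth_open (\<lambda>t. P (\<gamma> t)) {-e<..<e}"
    unfolding smooth_open_def
  proof (intro conjI allI)
    show "cont_diff k (\<lambda>t. P (\<gamma> t)) {-e<..<e}" for k
      using \<gamma>(2) by (intro cont_diff_linear_comp[OF _ assms(1), of _ _ \<gamma>]) (auto simp: smooth_open_def)
  qed simp
  moreover have "((\<lambda>t. P (\<gamma> t)) has_vector_derivative P v) (at 0)"
    by (rule bounded_linear.has_vector_derivative[OF assms(1) \<gamma>(5)])
  ultimately show ?thesis
    unfolding tangent_space_def using \<gamma> assms(2)
    by (intro CollectI exI[of _ "\<lambda>t. P (\<gamma> t)"] exI[of _ e]) auto
qed

subsection \<open>Clarke tangent cones and subgradients\<close>

text \<open>Chart-free reading of the tangent cone: the strict derivative of the inverse chart takes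
  quotients in coordinates back to the ambient space. With the converse
  \<open>mfd_tangent_coneI\<close>, cones on different manifolds and in different charts become
  comparable.\<close>

lemma mfd_tangent_coneD:
  fixes M :: "'a::euclidean_space set"
  assumes chart: "chart_at M x U \<psi>" and "S \<subseteq> M" and v: "v \<in> mfd_tangent_cone M U \<psi> S x"
    and y: "\<And>j. y j \<in> S" "y \<longlonglongrightarrow> x" and t: "\<And>j. t j > 0" "t \<longlonglongrightarrow> 0"
  obtains z where "\<And>j. z j \<in> S" "(\<lambda>j. (z j - y j) /\<^sub>R t j) \<longlonglongrightarrow> v"
proof -
  obtain g' h' where g': "strict_derivative_within \<psi> g' x U"
    and h': "strict_derivative_within (inv_into U \<psi>) h' (\<psi> x) (\<psi> ` U)"
    and c: "\<And>v. v \<in> tangent_space M x \<Longrightarrow> chart_deriv U \<psi> x v = g' v"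
      "\<And>v. v \<in> tangent_space M x \<Longrightarrow> h' (g' v) = v"
    using chart_at_coordinates[OF chart] by metis
  have xU: "x \<in> U" and inj: "inj_on \<psi> U" using chart unfolding chart_at_def chart_dim_def by blast+
  have vT: "v \<in> tangent_space M x" and vC: "g' v \<in> tangent_cone (\<psi> ` (S \<inter> U)) (\<psi> x)"
    using v c(1) unfolding mfd_tangent_cone_def by auto
  have yU: "\<forall>\<^sub>F j in sequentially. y j \<in> U"
    using chart_at_eventually_mem[OF chart y(2)] y(1) \<open>S \<subseteq> M\<close> by (simp add: subsetD)
  then obtain n where n: "\<And>j. j \<ge> n \<Longrightarrow> y j \<in> U" unfolding eventually_sequentially by blast
  \<comment> \<open>\<open>tangent_cone\<close> tests sequences that lie in the coordinate set from
    the first index on, while \<open>y\<close> lies in \<open>U\<close> only eventually; hence the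
    shift by n.\<close>
  define y' where "y' j = y (j + n)" for j
  define t' where "t' j = t (j + n)" for j
  have y'S: "y' j \<in> S \<inter> U" for j using n y(1) by (simp add: y'_def)
  have y'x: "y' \<longlonglongrightarrow> x" unfolding y'_def by (rule LIMSEQ_ignore_initial_segment[OF y(2)])
  have t'0: "t' \<longlonglongrightarrow> 0" unfolding t'_def by (rule LIMSEQ_ignore_initial_segment[OF t(2)])
  have t'pos: "t' j > 0" for j using t(1) by (simp add: t'_def)
  have cont: "continuous (at x within U) \<psi>"
    using strict_derivative_has_derivative[OF g' xU] has_derivative_continuous by blast
  have \<psi>y': "(\<lambda>j. \<psi> (y' j)) \<longlonglongrightarrow> \<psi> x"
    by (rule continuous_within_tendsto_compose'[OF cont _ y'x]) (use y'S in auto)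
  have "\<exists>w'. w' \<longlonglongrightarrow> g' v \<and> (\<forall>j. \<psi> (y' j) + t' j *\<^sub>R w' j \<in> \<psi> ` (S \<inter> U))"
    using vC[unfolded tangent_cone_def, simplified, rule_format, of "\<lambda>j. \<psi> (y' j)" t']
      \<psi>y' t'0 t'pos y'S by blast
  then obtain w' where w': "w' \<longlonglongrightarrow> g' v" "\<And>j. \<psi> (y' j) + t' j *\<^sub>R w' j \<in> \<psi> ` (S \<inter> U)"
    by blast
  define z' where "z' j = inv_into U \<psi> (\<psi> (y' j) + t' j *\<^sub>R w' j)" for j
  have z'S: "z' j \<in> S" for j
    using w'(2)[of j] inj unfolding z'_def by auto
  have "(\<lambda>j. (inv_into U \<psi> (\<psi> (y' j) + t' j *\<^sub>R w' j) - inv_into U \<psi> (\<psi> (y' j))) /\<^sub>R t' j)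
      \<longlonglongrightarrow> h' (g' v)"
  proof (rule strict_derivative_tendsto[OF h' \<psi>y' t'0])
    show "\<forall>\<^sub>F j in sequentially. t' j \<noteq> 0" using t'pos by (simp add: less_imp_neq[symmetric])
    show "(\<lambda>j. (\<psi> (y' j) + t' j *\<^sub>R w' j - \<psi> (y' j)) /\<^sub>R t' j) \<longlonglongrightarrow> g' v"
      using w'(1) t'pos by (simp add: less_imp_neq[symmetric])
    show "\<forall>\<^sub>F j in sequentially. \<psi> (y' j) \<in> \<psi> ` U" using y'S by simp
    show "\<forall>\<^sub>F j in sequentially. \<psi> (y' j) + t' j *\<^sub>R w' j \<in> \<psi> ` U" 
      using w'(2) image_mono[of "S \<inter> U" U \<psi>] by (intro always_eventually allI) blast
  qed
  then have lim': "(\<lambda>j. (z' j - y' j) /\<^sub>R t' j) \<longlonglongrightarrow> v"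
    using c(2)[OF vT] y'S inj by (simp add: z'_def)
  \<comment> \<open>Undoes the shift; the first n terms only have to lie in \<open>S\<close>, and
    \<open>y j\<close> does.\<close>
  define z where "z j = (if j < n then y j else z' (j - n))" for j
  have "(\<lambda>j. (z (j + n) - y (j + n)) /\<^sub>R t (j + n)) \<longlonglongrightarrow> v"
    using lim' by (simp add: z_def y'_def t'_def)
  then have "(\<lambda>j. (z j - y j) /\<^sub>R t j) \<longlonglongrightarrow> v" by (rule LIMSEQ_offset)
  moreover have "z j \<in> S" for j using y(1) z'S by (simp add: z_def)
  ultimately show ?thesis using that by blast
qed

text \<open>A test sequence in coordinates is pulled back to \<open>S\<close>, the hypothesis
  supplies endpoints there, and the strict derivative of \<psi> pushes the quotients
  forward.\<close>

lemma mfd_tangent_coneI: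
  fixes M :: "'a::euclidean_space set"
  assumes chart: "chart_at M x U \<psi>" and "S \<subseteq> M" and vT: "v \<in> tangent_space M x"
    and ex: "\<And>y t. (\<And>j. y j \<in> S) \<Longrightarrow> y \<longlonglongrightarrow> x \<Longrightarrow> (\<And>j. t j > 0) \<Longrightarrow> t \<longlonglongrightarrow> 0 \<Longrightarrow>
      \<exists>z. (\<forall>j::nat. z j \<in> S) \<and> (\<lambda>j. (z j - y j) /\<^sub>R t j) \<longlonglongrightarrow> v"
  shows "v \<in> mfd_tangent_cone M U \<psi> S x"
proof -
  obtain g' h' where g': "strict_derivative_within \<psi> g' x U"
    and h': "strict_derivative_within (inv_into U \<psi>) h' (\<psi> x) (\<psi> ` U)"
    and c: "\<And>v. v \<in> tangent_space M x \<Longrightarrow> chart_deriv U \<psi> x v = g' v"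
    using chart_at_coordinates[OF chart] by metis
  have xU: "x \<in> U" and inj: "inj_on \<psi> U" using chart unfolding chart_at_def chart_dim_def by blast+
  let ?i = "inv_into U \<psi>"
  have "\<exists>w'. w' \<longlonglongrightarrow> g' v \<and> (\<forall>j. s j + t j *\<^sub>R w' j \<in> \<psi> ` (S \<inter> U))"
    if s: "\<forall>j. s j \<in> \<psi> ` (S \<inter> U)" "s \<longlonglongrightarrow> \<psi> x" and t: "\<forall>j. t j > 0" "t \<longlonglongrightarrow> 0" for s t
  proof -
    define y where "y j = ?i (s j)" for j
    have y: "y j \<in> S \<inter> U" "\<psi> (y j) = s j" for j
      using s(1)[rule_format, of j] inj by (auto simp: y_def)
    have "continuous (at (\<psi> x) within \<psi> ` U) ?i"
      using strict_derivative_has_derivative[OF h'] has_derivative_continuous xU by blast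
    then have "y \<longlonglongrightarrow> ?i (\<psi> x)"
      unfolding y_def by (rule continuous_within_tendsto_compose'[OF _ _ s(2)]) (use s(1) in auto)
    then have yx: "y \<longlonglongrightarrow> x" using inj xU by simp
    obtain z where z: "\<And>j. z j \<in> S" "(\<lambda>j. (z j - y j) /\<^sub>R t j) \<longlonglongrightarrow> v"
      using ex[of y t] y yx t by blast
    have tn0: "t j \<noteq> 0" for j using t(1) by (metis less_irrefl)
    have "z \<longlonglongrightarrow> x"
      by (rule difference_quotient_endpoint_tendsto[OF yx t(2) _ z(2)]) (simp add: tn0)
    then have zU: "\<forall>\<^sub>F j in sequentially. z j \<in> U"
      by (rule chart_at_eventually_mem[OF chart]) (use z(1) \<open>S \<subseteq> M\<close> in \<open>auto intro: always_eventually\<close>)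
    \<comment> \<open>Finitely many \<open>z j\<close> may lie outside \<open>U\<close>. With the
      value 0 there, \<open>s j + t j *\<^sub>R w' j\<close> is \<open>s j\<close> itself, which is
      in the coordinate set.\<close>
    define w' where "w' j = (if z j \<in> U then (\<psi> (z j) - s j) /\<^sub>R t j else 0)" for j
    have "(\<lambda>j. (\<psi> (z j) - \<psi> (y j)) /\<^sub>R t j) \<longlonglongrightarrow> g' v"
      by (rule strict_derivative_tendsto[OF g' yx t(2) _ z(2)])
        (use zU y tn0 in auto)
    moreover have "\<forall>\<^sub>F j in sequentially. (\<psi> (z j) - \<psi> (y j)) /\<^sub>R t j = w' j"
      using zU by eventually_elim (simp add: w'_def y)
    ultimately have "w' \<longlonglongrightarrow> g' v" by (rule Lim_transform_eventually)
    moreover have "s j + t j *\<^sub>R w' j \<in> \<psi> ` (S \<inter> U)" for j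
      using z(1) s(1) tn0 by (simp add: w'_def)
    ultimately show ?thesis by blast
  qed
  then have "g' v \<in> tangent_cone (\<psi> ` (S \<inter> U)) (\<psi> x)" unfolding tangent_cone_def by blast
  then show ?thesis unfolding mfd_tangent_cone_def using vT c by simp
qed

text \<open>The continuous section \<open>\<sigma>\<close> of \<open>P\<close> is what makes this true: Clarke cones are in general
  not mapped into Clarke cones by linear maps.\<close>

lemma mfd_tangent_cone_linear_image:
  fixes M :: "'a::euclidean_space set" and M' :: "'b::euclidean_space set"
  assumes chart: "chart_at M x U \<psi>" and chart': "chart_at M' (P x) U' \<psi>'"
    and S: "S \<subseteq> M" and S': "S' \<subseteq> M'" and P: "bounded_linear P" "P ` M \<subseteq> M'" "P ` S \<subseteq> S'"
    and \<sigma>: "\<And>y. y \<in> S' \<Longrightarrow> \<sigma> y \<in> S" "\<And>y. y \<in> S' \<Longrightarrow> P (\<sigma> y) = y" "\<sigma> (P x) = x"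
      "isCont \<sigma> (P x)"
    and v: "v \<in> mfd_tangent_cone M U \<psi> S x"
  shows "P v \<in> mfd_tangent_cone M' U' \<psi>' S' (P x)"
proof (rule mfd_tangent_coneI[OF chart' S'])
  show "P v \<in> tangent_space M' (P x)"
    using v by (intro tangent_space_linear_image[OF P(1,2)]) (simp add: mfd_tangent_cone_def)
  fix y t assume y: "\<And>j. y j \<in> S'" "y \<longlonglongrightarrow> P x" and t: "\<And>j. t j > 0" "t \<longlonglongrightarrow> (0::real)"
  \<comment> \<open>The test sequence in \<open>S'\<close> is lifted to \<open>S\<close>; the cone
    of \<open>S\<close> yields endpoints for the lift, and \<open>P\<close> maps their quotients
    down again.\<close>
  have "(\<lambda>j. \<sigma> (y j)) \<longlonglongrightarrow> x"
    using isCont_tendsto_compose[OF \<sigma>(4) y(2)] \<sigma>(3) by simp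
  then obtain z where z: "\<And>j. z j \<in> S" "(\<lambda>j. (z j - \<sigma> (y j)) /\<^sub>R t j) \<longlonglongrightarrow> v"
    using mfd_tangent_coneD[OF chart S v, of "\<lambda>j. \<sigma> (y j)" t] \<sigma>(1) y(1) t by blast
  have "(\<lambda>j. P ((z j - \<sigma> (y j)) /\<^sub>R t j)) \<longlonglongrightarrow> P v"
    by (rule bounded_linear.tendsto[OF P(1) z(2)])
  then have "(\<lambda>j. (P (z j) - y j) /\<^sub>R t j) \<longlonglongrightarrow> P v"
    using P(1) \<sigma>(2)[OF y(1)]
    by (simp add: linear_cmul linear_diff bounded_linear.linear)
  then show "\<exists>z. (\<forall>j. z j \<in> S') \<and> (\<lambda>j. (z j - y j) /\<^sub>R t j) \<longlonglongrightarrow> P v"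
    using z(1) P(3) by (intro exI[of _ "\<lambda>j. P (z j)"]) auto
qed

text \<open>Testing the cone with the constant sequence \<open>x\<close> writes v as a limit of
  multiples of z j - x with z j in \<open>S\<close>, and \<open>L\<close> vanishes on all of
  them.\<close>

lemma mfd_tangent_cone_affine_constraint:
  fixes M :: "'a::euclidean_space set" and L :: "'a \<Rightarrow> 'b::real_normed_vector"
  assumes chart: "chart_at M x U \<psi>" and "S \<subseteq> M" "x \<in> S" and L: "bounded_linear L"
    and b: "\<And>y. y \<in> S \<Longrightarrow> L y = b" and v: "v \<in> mfd_tangent_cone M U \<psi> S x"
  shows "L v = 0"
proof -
  obtain z where z: "\<And>j. z j \<in> S" "(\<lambda>j. (z j - x) /\<^sub>R inverse (real (Suc j))) \<longlonglongrightarrow> v"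
    using mfd_tangent_coneD[OF chart \<open>S \<subseteq> M\<close> v, of "\<lambda>_. x" "\<lambda>j. inverse (real (Suc j))"]
      \<open>x \<in> S\<close> LIMSEQ_inverse_real_of_nat by auto
  have "(\<lambda>j. L ((z j - x) /\<^sub>R inverse (real (Suc j)))) \<longlonglongrightarrow> L v"
    by (rule bounded_linear.tendsto[OF L z(2)])
  moreover have "L ((z j - x) /\<^sub>R inverse (real (Suc j))) = 0" for j
    using b[OF z(1)] b[OF \<open>x \<in> S\<close>] L
    by (simp add: linear_cmul linear_diff bounded_linear.linear)
  ultimately show ?thesis by (simp add: LIMSEQ_const_iff)
qed

text \<open>Only a lower bound on the upper limit is required, and the base point y = x already
  gives one: along the coordinate line through \<psi> x the minorant in \<open>G\<close> has
  difference quotients tending to \<xi> \<bullet> v.\<close>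

lemma clarke_subdiffI:
  fixes M :: "'a::euclidean_space set"
  assumes chart: "chart_at M x U \<psi>" and \<xi>: "\<xi> \<in> tangent_space M x"
    and f: "(f has_derivative f') (at x)" and G: "\<And>y. y \<in> M \<Longrightarrow> F x + (f y - f x) + G \<bullet> (y - x) \<le> F y"
    and eq: "\<And>v. v \<in> tangent_space M x \<Longrightarrow> \<xi> \<bullet> v = f' v + G \<bullet> v"
  shows "\<xi> \<in> clarke_subdiff M U \<psi> F x"
  unfolding clarke_subdiff_def
proof (intro CollectI conjI \<xi> ballI)
  fix v assume v: "v \<in> tangent_space M x"
  obtain E g' h' where E: "subspace E" and open\<psi>: "openin (top_of_set E) (\<psi> ` U)"
    and h': "strict_derivative_within (inv_into U \<psi>) h' (\<psi> x) (\<psi> ` U)"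
    and c: "chart_deriv U \<psi> x v = g' v" "g' v \<in> E" "h' (g' v) = v"
    using chart_at_coordinates[OF chart] v by metis
  have xU: "x \<in> U" and inj: "inj_on \<psi> U" and UM: "U \<subseteq> M"
    using chart openin_imp_subset unfolding chart_at_def chart_dim_def by blast+
  let ?i = "inv_into U \<psi>" and ?F = "at_right (0::real)"
  let ?z = "\<lambda>t. ?i (\<psi> x + t *\<^sub>R g' v)"
  let ?q = "\<lambda>(y, t). ereal ((F (?i (\<psi> y + t *\<^sub>R g' v)) - F (?i (\<psi> y))) / t)"
  obtain O' where O': "open O'" "\<psi> ` U = E \<inter> O'" using open\<psi> unfolding openin_open by blast
  have lim: "((\<lambda>t. \<psi> x + t *\<^sub>R g' v) \<longlongrightarrow> \<psi> x + 0 *\<^sub>R g' v) ?F" by (intro tendsto_intros)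
  have "\<psi> x \<in> E" "\<psi> x \<in> O'" using O'(2) xU by blast+
  then have "\<forall>\<^sub>F t in ?F. \<psi> x + t *\<^sub>R g' v \<in> O'"
    using topological_tendstoD[OF lim O'(1)] by simp
  moreover have "\<psi> x + t *\<^sub>R g' v \<in> E" for t
    using c(2) \<open>\<psi> x \<in> E\<close> by (intro subspace_add[OF E] subspace_scale[OF E])
  ultimately have in\<psi>: "\<forall>\<^sub>F t in ?F. \<psi> x + t *\<^sub>R g' v \<in> \<psi> ` U" by (simp add: O'(2))
  then have zU: "\<forall>\<^sub>F t in ?F. ?z t \<in> U" by eventually_elim (rule inv_into_into)
  have pos: "\<forall>\<^sub>F t in ?F. t > 0" by (simp add: eventually_at_right_less)
  have t0: "((\<lambda>t. t) \<longlongrightarrow> 0) ?F" by (rule tendsto_ident_at)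
  have tn0: "\<forall>\<^sub>F t in ?F. t \<noteq> 0" using pos by eventually_elim simp
  have "((\<lambda>t. (?z t - ?i (\<psi> x)) /\<^sub>R t) \<longlongrightarrow> h' (g' v)) ?F"
  proof (rule strict_derivative_tendsto[OF h' _ t0 tn0 _ _ in\<psi>])
    have "\<forall>\<^sub>F t in ?F. g' v = (\<psi> x + t *\<^sub>R g' v - \<psi> x) /\<^sub>R t"
      using tn0 by eventually_elim simp
    then show "((\<lambda>t. (\<psi> x + t *\<^sub>R g' v - \<psi> x) /\<^sub>R t) \<longlongrightarrow> g' v) ?F"
      by (rule Lim_transform_eventually[OF tendsto_const])
  qed (use xU in auto)
  then have zlim: "((\<lambda>t. (?z t - x) /\<^sub>R t) \<longlongrightarrow> v) ?F" using c(3) inj xU by simp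
  have flim: "((\<lambda>t. (f (?z t) - f x) /\<^sub>R t) \<longlongrightarrow> f' v) ?F"
    by (rule has_derivative_difference_quotient_tendsto[OF f t0 tn0 zlim])
  have qlim: "((\<lambda>t. (f (?z t) - f x) /\<^sub>R t + G \<bullet> ((?z t - x) /\<^sub>R t)) \<longlongrightarrow> \<xi> \<bullet> v) ?F"
    unfolding eq[OF v] by (intro tendsto_intros flim zlim)
  \<comment> \<open>Freezing y = x is a legitimate approach because the filter \<open>nhds x\<close>
    does not exclude \<open>x\<close>.\<close>
  have xt: "filterlim (\<lambda>t. (x, t)) (inf (nhds x) (principal U) \<times>\<^sub>F ?F) ?F"
  proof (rule filterlim_Pair)
    have "filterlim (\<lambda>t. x) (nhds x) ?F" by (rule tendsto_const)
    moreover have "filterlim (\<lambda>t. x) (principal U) ?F" using xU by (simp add: filterlim_principal)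
    ultimately show "filterlim (\<lambda>t. x) (inf (nhds x) (principal U)) ?F"
      by (simp add: filterlim_inf)
  qed (rule filterlim_ident)
  have "ereal (\<xi> \<bullet> v) \<le> Limsup (inf (nhds x) (principal U) \<times>\<^sub>F ?F) ?q"
  proof (rule ccontr)
    \<comment> \<open>A real c strictly between the upper limit and \<xi> \<bullet> v would
      eventually bound the quotients of \<open>F\<close> at \<open>x\<close> from above, yet lie
      below the quotients of the minorant.\<close>
    assume "\<not> ?thesis"
    then obtain c where c1: "Limsup (inf (nhds x) (principal U) \<times>\<^sub>F ?F) ?q < ereal c"
      and c2: "ereal c < ereal (\<xi> \<bullet> v)"
      by (meson ereal_dense2 not_le)
    have "\<forall>\<^sub>F p in inf (nhds x) (principal U) \<times>\<^sub>F ?F. ?q p < ereal c"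
      using c1 by (rule Limsup_lessD)
    then have "\<forall>\<^sub>F t in ?F. ?q (x, t) < ereal c"
      using xt by (rule eventually_compose_filterlim)
    moreover have "\<forall>\<^sub>F t in ?F. c < (f (?z t) - f x) /\<^sub>R t + G \<bullet> ((?z t - x) /\<^sub>R t)"
      using qlim c2 by (intro order_tendstoD(1)[OF qlim]) simp
    ultimately have "\<forall>\<^sub>F t in ?F. False"
      using zU pos
    proof eventually_elim
      case (elim t)
      have "F x + (f (?z t) - f x) + G \<bullet> (?z t - x) \<le> F (?z t)" using G elim(3) UM by blast
      then have "((f (?z t) - f x) + G \<bullet> (?z t - x)) / t \<le> (F (?z t) - F x) / t"
        using elim(4) by (intro divide_right_mono) auto
      moreover have "((f (?z t) - f x) + G \<bullet> (?z t - x)) / t =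
          (f (?z t) - f x) /\<^sub>R t + G \<bullet> ((?z t - x) /\<^sub>R t)"
        by (simp add: divide_inverse_commute distrib_left)
      moreover have "(F (?z t) - F x) / t < c" using elim(1) inj xU by simp
      ultimately show False using elim(2) by linarith
    qed
    then show False by simp
  qed
  then show "ereal (\<xi> \<bullet> v) \<le> clarke_dderiv U \<psi> F x v"
    unfolding clarke_dderiv_def c(1) .
qed

subsection \<open>The block structure\<close>

lemma bounded_linear_block:
  "bounded_linear (block blk i :: (real^'k::finite) \<times> (real^'m::finite) \<Rightarrow> real^'k)"
  by (rule linear_conv_bounded_linear[THEN iffD1], rule linearI)
    (simp_all add: block_def vec_eq_iff)

lemma bounded_linear_lhs:
  "bounded_linear (lhs N blk A :: (real^'k::finite) \<times> (real^'m::finite) \<Rightarrow> real^'m)"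
proof -
  have "linear (block blk i :: (real^'k) \<times> (real^'m) \<Rightarrow> real^'k)" for i
    by (rule bounded_linear.linear[OF bounded_linear_block])
  then have "linear (lhs N blk A :: (real^'k) \<times> (real^'m) \<Rightarrow> real^'m)"
    by (intro linearI) (simp_all add: lhs_def last_block_def linear_add linear_cmul
        matrix_vector_right_distrib matrix_vector_mult_scaleR sum.distrib scaleR_right.sum scaleR_right_distrib)
  then show ?thesis by (simp add: linear_conv_bounded_linear)
qed

lemma block_in_blk_space: "block blk i v \<in> blk_space blk i"
  by (simp add: block_def blk_space_def)

lemma inner_blk_space:
  assumes "u \<in> blk_space blk i"
  shows "u \<bullet> fst v = u \<bullet> block blk i v"
  unfolding inner_vec_def using assms by (intro sum.cong) (auto simp: blk_space_def block_def)

lemma sum_block: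
  assumes "\<And>c. blk c \<in> I" "finite I"
  shows "(\<Sum>i\<in>I. block blk i v) = fst v"
  using assms by (simp add: vec_eq_iff block_def sum.delta')

text \<open>Each coordinate belongs to exactly one block, so the blocks sum to the vector and
  distinct blocks are orthogonal.\<close>

lemma inner_fst_eq_sum_block:
  assumes "\<And>c. blk c \<in> I" "finite I"
  shows "fst u \<bullet> fst v = (\<Sum>i\<in>I. block blk i u \<bullet> block blk i v)"
proof -
  have "fst u \<bullet> fst v = (\<Sum>i\<in>I. block blk i u) \<bullet> fst v"
    by (subst sum_block[OF assms]) (rule refl)
  also have "\<dots> = (\<Sum>i\<in>I. block blk i u \<bullet> fst v)" by (rule inner_sum_left)
  finally show ?thesis by (simp only: inner_blk_space[OF block_in_blk_space])
qed

lemma block_replace: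
  assumes "y \<in> blk_space blk i"
  shows "block blk k (fst x - block blk i x + y, w) = (if k = i then y else block blk k x)"
  using assms by (auto simp: block_def blk_space_def vec_eq_iff)

text \<open>Since \<open>A\<^sub>N = I\<close>, the last block is a function of the others, so that replacing one block of
  a feasible point by another admissible value stays feasible.\<close>

lemma feasible_section:
  fixes x :: "(real^'k::finite) \<times> (real^'m::finite)"
  assumes x: "x \<in> feasible_set N blk A b M X"
    and M: "M i \<subseteq> blk_space blk i"
  obtains \<sigma> where "\<And>y. y \<in> X i \<inter> M i \<Longrightarrow> \<sigma> y \<in> feasible_set N blk A b M X"
    "\<And>y. y \<in> X i \<inter> M i \<Longrightarrow> block blk i (\<sigma> y) = y" "\<sigma> (block blk i x) = x" "isCont \<sigma> (block blk i x)"
proof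
  define p where "p y = fst x - block blk i x + y" for y
  \<comment> \<open>The last component is solved from the linear constraint. The 0 is a placeholder,
    since \<open>block\<close> reads only the first component.\<close>
  define \<sigma> where "\<sigma> y = (p y, b - (\<Sum>k\<in>{1..<N}. A k *v block blk k (p y, 0 :: real^'m)))" for y
  have block: "block blk k (p y, w) = (if k = i then y else block blk k x)"
    if "y \<in> blk_space blk i" for k y and w :: "real^'m"
    unfolding p_def by (rule block_replace[OF that])
  show "\<sigma> y \<in> feasible_set N blk A b M X" if "y \<in> X i \<inter> M i" for y
    using that x M block by (auto simp: feasible_set_def \<sigma>_def lhs_def last_block_def)
  show "block blk i (\<sigma> y) = y" if "y \<in> X i \<inter> M i" for y
    using that M block by (auto simp: \<sigma>_def)
  have "block blk k (fst x, 0 :: real^'m) = block blk k x" for k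
    by (simp add: block_def vec_eq_iff)
  then show "\<sigma> (block blk i x) = x"
    using x by (auto simp: \<sigma>_def p_def feasible_set_def lhs_def last_block_def prod_eq_iff)
  have "isCont p y" for y unfolding p_def by (intro continuous_intros)
  then have "isCont (\<lambda>y. (p y, 0 :: real^'m)) y" for y by (intro continuous_intros)
  then have "isCont (\<lambda>y. A k *v block blk k (p y, 0 :: real^'m)) y" for k y
    by (intro bounded_linear.isCont[OF matrix_vector_mul_bounded_linear]
        bounded_linear.isCont[OF bounded_linear_block])
  then show "isCont \<sigma> (block blk i x)"
    unfolding \<sigma>_def using \<open>\<And>y. isCont p y\<close> by (intro continuous_intros)
qed

section \<open>From the KKT system to stationarity\<close>

theorem theorem2p8:
  fixes N :: nat
    and blk :: "'k::finite \<Rightarrow> nat"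
    and f :: "(real^'k) \<times> (real^'m::finite) \<Rightarrow> real"
    and r :: "nat \<Rightarrow> real^'k \<Rightarrow> real"
    and A :: "nat \<Rightarrow> real^'k^'m"
    and b :: "real^'m"
    and M X :: "nat \<Rightarrow> (real^'k) set"
    and x :: "(real^'k) \<times> (real^'m)"
    and W :: "nat \<Rightarrow> (real^'k) set"
    and \<phi> :: "nat \<Rightarrow> real^'k \<Rightarrow> real^'k"
  assumes blk: "\<And>c. blk c \<in> {1..<N}"
    and A: "\<And>i j c. i \<in> {1..<N} \<Longrightarrow> blk c \<noteq> i \<Longrightarrow> A i $ j $ c = 0"
    and M: "\<And>i. i \<in> {1..<N} \<Longrightarrow> M i \<subseteq> blk_space blk i \<and> embedded_submanifold (M i)"
    and X: "\<And>i. i \<in> {1..<N} \<Longrightarrow> X i \<subseteq> blk_space blk i \<and> closed (X i) \<and> convex (X i)"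
    and f_diff: "\<And>y. f differentiable (at y)"
    and f_lipschitz_grad: "\<exists>L. L-lipschitz_on UNIV (grad f)"
    and r_convex: "\<And>i. i \<in> {1..<N} \<Longrightarrow> convex_on (blk_space blk i) (r i)"
    and r_lipschitz: "\<And>i. i \<in> {1..<N} \<Longrightarrow> locally_lipschitz_on (blk_space blk i) (r i)"
    and x: "\<And>i. i \<in> {1..<N} \<Longrightarrow> block blk i x \<in> M i \<inter> X i"
    and charts: "\<And>i. i \<in> {1..<N} \<Longrightarrow> chart_at (M i) (block blk i x) (W i) (\<phi> i)"
    and kkt: "\<exists>lam :: real^'m.
        grad_last f x - transpose (mat 1) *v lam = 0 \<and>
        lhs N blk A x - b = 0 \<and>
        (\<forall>i\<in>{1..<N}.
           0 \<in> (\<lambda>g. orth_proj (tangent_space (M i) (block blk i x))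
                      (grad_block blk i f x - transpose (A i) *v lam + g)) `
                 convex_subdiff (blk_space blk i) (r i) (block blk i x)
               + mfd_normal_cone (M i) (W i) (\<phi> i) (X i \<inter> M i) (block blk i x))"
  shows "stationary_solution N blk f r A b M X x"
proof -
  let ?I = "{1..<N}" and ?\<M> = "product_manifold N blk M :: ((real^'k) \<times> (real^'m)) set" and ?S = "feasible_set N blk A b M X"
  let ?F = "objective N blk f r" and ?T = "\<lambda>i. tangent_space (M i) (block blk i x)"
  \<comment> \<open>Since the last matrix is the identity, the KKT equation of the last block
    identifies the multiplier with that block of the gradient.\<close>
  obtain lam where lam: "snd (grad f x) = lam" and lhs: "lhs N blk A x = b"
    and blocks: "\<forall>i\<in>?I. 0 \<in> (\<lambda>g. orth_proj (?T i) (block blk i (grad f x) - transpose (A i) *v lam + g)) `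
        convex_subdiff (blk_space blk i) (r i) (block blk i x)
      + mfd_normal_cone (M i) (W i) (\<phi> i) (X i \<inter> M i) (block blk i x)"
    using kkt by (auto simp: grad_last_def last_block_def grad_block_def transpose_mat)
  have "\<forall>i\<in>?I. \<exists>g. g \<in> convex_subdiff (blk_space blk i) (r i) (block blk i x) \<and>
      - orth_proj (?T i) (block blk i (grad f x) - transpose (A i) *v lam + g)
        \<in> mfd_normal_cone (M i) (W i) (\<phi> i) (X i \<inter> M i) (block blk i x)"
  proof
    fix i assume "i \<in> ?I"
    with blocks obtain g n where "g \<in> convex_subdiff (blk_space blk i) (r i) (block blk i x)"
      "n \<in> mfd_normal_cone (M i) (W i) (\<phi> i) (X i \<inter> M i) (block blk i x)"
      "0 = orth_proj (?T i) (block blk i (grad f x) - transpose (A i) *v lam + g) + n"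
      unfolding set_plus_def by blast
    then show "\<exists>g. g \<in> convex_subdiff (blk_space blk i) (r i) (block blk i x) \<and>
      - orth_proj (?T i) (block blk i (grad f x) - transpose (A i) *v lam + g)
        \<in> mfd_normal_cone (M i) (W i) (\<phi> i) (X i \<inter> M i) (block blk i x)"
      by (metis minus_unique)
  qed
  then obtain g where g: "\<And>i. i \<in> ?I \<Longrightarrow> g i \<in> convex_subdiff (blk_space blk i) (r i) (block blk i x)"
    and n: "\<And>i. i \<in> ?I \<Longrightarrow> - orth_proj (?T i) (block blk i (grad f x) - transpose (A i) *v lam + g i)
        \<in> mfd_normal_cone (M i) (W i) (\<phi> i) (X i \<inter> M i) (block blk i x)"
    by (metis (no_types, lifting) bchoice)
  \<comment> \<open>Each \<open>g i\<close> is supported on its own block, so the sum concatenates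
    them; the last component is 0 because no \<open>r i\<close> acts on the last block.\<close>
  define G :: "(real^'k) \<times> (real^'m)" where "G = (\<Sum>i\<in>?I. g i, 0)"
  have G: "G \<bullet> v = (\<Sum>i\<in>?I. g i \<bullet> block blk i v)" for v
  proof -
    have "G \<bullet> v = (\<Sum>i\<in>?I. g i \<bullet> fst v)" by (simp add: G_def inner_prod_def inner_sum_left)
    also have "\<dots> = (\<Sum>i\<in>?I. g i \<bullet> block blk i v)"
      using g by (intro sum.cong inner_blk_space) (auto simp: convex_subdiff_def)
    finally show ?thesis .
  qed
  have xS: "x \<in> ?S" using x lhs by (auto simp: feasible_set_def)
  have SM: "?S \<subseteq> ?\<M>" by (auto simp: feasible_set_def product_manifold_def)
  have block_linear: "linear (block blk i :: (real^'k) \<times> (real^'m) \<Rightarrow> real^'k)" for i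
    by (rule bounded_linear.linear[OF bounded_linear_block])
  have "0 \<in> clarke_subdiff ?\<M> U \<psi> ?F x + mfd_normal_cone ?\<M> U \<psi> ?S x"
    if chart: "chart_at ?\<M> x U \<psi>" for U \<psi>
  proof -
    \<comment> \<open>Projecting makes the vector tangent without changing its inner products with
      tangent vectors.\<close>
    define \<xi> where "\<xi> = orth_proj (tangent_space ?\<M> x) (grad f x + G)"
    have subsp: "subspace (tangent_space ?\<M> x)" by (rule subspace_tangent_space[OF chart])
    have \<xi>: "\<xi> \<in> tangent_space ?\<M> x"
      and \<xi>_inner: "\<And>v. v \<in> tangent_space ?\<M> x \<Longrightarrow> \<xi> \<bullet> v = grad f x \<bullet> v + G \<bullet> v"
      unfolding \<xi>_def using orth_proj_subspace[OF subsp] by (simp_all add: inner_add_left)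
    have "\<xi> \<in> clarke_subdiff ?\<M> U \<psi> ?F x"
    proof (rule clarke_subdiffI[OF chart \<xi> grad_has_derivative[OF f_diff] _ \<xi>_inner])
      fix y assume "y \<in> ?\<M>"
      \<comment> \<open>The subgradient inequalities of the blocks add up to the affine minorant of
        the nonsmooth part.\<close>
      have "(\<Sum>i\<in>?I. r i (block blk i x) + g i \<bullet> (block blk i y - block blk i x))
          \<le> (\<Sum>i\<in>?I. r i (block blk i y))"
        using g block_in_blk_space[of blk _ y] by (intro sum_mono) (auto simp: convex_subdiff_def)
      then show "?F x + (f y - f x) + G \<bullet> (y - x) \<le> ?F y"
        by (simp add: objective_def G sum.distrib linear_diff[OF block_linear])
    qed
    moreover have "- \<xi> \<in> mfd_normal_cone ?\<M> U \<psi> ?S x"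
      unfolding mfd_normal_cone_def
    proof (intro CollectI conjI ballI)
      show "- \<xi> \<in> tangent_space ?\<M> x" using subsp \<xi> by (rule subspace_neg)
      fix v assume v: "v \<in> mfd_tangent_cone ?\<M> U \<psi> ?S x"
      then have vT: "v \<in> tangent_space ?\<M> x" by (simp add: mfd_tangent_cone_def)
      have "lhs N blk A v = 0"
        by (rule mfd_tangent_cone_affine_constraint[OF chart SM xS bounded_linear_lhs _ v])
          (simp add: feasible_set_def)
      then have "snd v = - (\<Sum>i\<in>?I. A i *v block blk i v)"
        by (simp add: lhs_def last_block_def eq_neg_iff_add_eq_0 add.commute)
      \<comment> \<open>The linearised constraint expresses the last block of v through the others,
        so its contribution cancels against the terms \<open>transpose (A i) *v lam\<close> of the
        KKT system.\<close>
      then have "lam \<bullet> snd v = - (\<Sum>i\<in>?I. (transpose (A i) *v lam) \<bullet> block blk i v)"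
        by (simp add: inner_sum_right transpose_matrix_vector dot_lmul_matrix)
      then have \<xi>v: "\<xi> \<bullet> v = (\<Sum>i\<in>?I. (block blk i (grad f x) - transpose (A i) *v lam + g i) \<bullet> block blk i v)"
        unfolding \<xi>_inner[OF vT] G inner_prod_def[of "grad f x"] lam
          inner_fst_eq_sum_block[where blk = blk, OF blk finite_atLeastLessThan]
        by (simp add: inner_add_left inner_diff_left sum.distrib sum_subtractf)
      have "0 \<le> (block blk i (grad f x) - transpose (A i) *v lam + g i) \<bullet> block blk i v"
        if i: "i \<in> ?I" for i
      proof -
        have Mi: "M i \<subseteq> blk_space blk i" using M[OF i] by blast
        obtain \<sigma> where \<sigma>: "\<And>y. y \<in> X i \<inter> M i \<Longrightarrow> \<sigma> y \<in> ?S"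
          "\<And>y. y \<in> X i \<inter> M i \<Longrightarrow> block blk i (\<sigma> y) = y" "\<sigma> (block blk i x) = x"
          "isCont \<sigma> (block blk i x)"
          using feasible_section[OF xS Mi] by metis
        have vi: "block blk i v \<in> mfd_tangent_cone (M i) (W i) (\<phi> i) (X i \<inter> M i) (block blk i x)"
          by (rule mfd_tangent_cone_linear_image[OF chart charts[OF i] SM _ bounded_linear_block _ _ \<sigma> v])
            (use i in \<open>auto simp: product_manifold_def feasible_set_def\<close>)
        \<comment> \<open>As the block of v is tangent to \<open>M i\<close>, the projection can be
          inserted into the inner product, and the normal cone condition \<open>n\<close> fixes the
          sign.\<close>
        have "subspace (?T i)" by (rule subspace_tangent_space[OF charts[OF i]])
        moreover have "block blk i v \<in> ?T i" using vi by (simp add: mfd_tangent_cone_def)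
        ultimately have "(block blk i (grad f x) - transpose (A i) *v lam + g i) \<bullet> block blk i v =
            orth_proj (?T i) (block blk i (grad f x) - transpose (A i) *v lam + g i) \<bullet> block blk i v"
          by (simp only: orth_proj_subspace(2))
        moreover have "- orth_proj (?T i) (block blk i (grad f x) - transpose (A i) *v lam + g i) \<bullet> block blk i v \<le> 0"
          using n[OF i] vi unfolding mfd_normal_cone_def by blast
        ultimately show ?thesis by simp
      qed
      then have "0 \<le> \<xi> \<bullet> v" unfolding \<xi>v by (rule sum_nonneg)
      then show "- \<xi> \<bullet> v \<le> 0" by simp
    qed
    ultimately have "\<xi> + - \<xi> \<in> clarke_subdiff ?\<M> U \<psi> ?F x + mfd_normal_cone ?\<M> U \<psi> ?S x"
      unfolding set_plus_def by blast
    then show ?thesis by simp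
  qed
  then show ?thesis unfolding stationary_solution_def Let_def using xS by blast
qed

end
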